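(* Let $d\ge 1$, $n\ge 3$ and $0\le k\le n$. Then any collection in the packet $\mathcal P(n,k)$ of $G(d,1,n)$ contains exactly $C(n,k)$ elements, where $C(n,k)=\frac{(n+k)!\,(n-k+1)}{k!\,(n+1)!}$.
   Context: Group: for positive integers $d,n$, $G(d,1,n)$ is the group generated by $s_1,\dots,s_n$ with defining relations $s_n^d=1$; $s_i^2=1$ $(1\le i\le n-1)$; $s_is_j=s_js_i$ $(j+1<i\le n)$; $s_{i+1}s_is_{i+1}=s_is_{i+1}s_i$ $(1\le i\le n-2)$; $s_ns_{n-1}s_ns_{n-1}=s_{n-1}s_ns_{n-1}s_n$. Canonical words: words are elements of the free monoid on $\{s_1,\dots,s_n\}$. Put $s_{ij}=s_is_{i-1}\cdots s_j$ if $i>j$, $s_{ii}=s_i$, $s_{ij}=$ the empty word if $i<j$; and $s^{(k)}_{nj}=s_n^k s_{n-1,j}$ for $k\ge1$, $1\le j\le n$. Every element of $G(d,1,n)$ has a unique canonical (reduced) word $s_{1i_1}s_{2i_2}\cdots s_{n-1,i_{n-1}}\,s^{(k_1)}_{nj_1}\cdots s^{(k_\ell)}_{nj_\ell}$ with $1\le i_p\le p+1$ for $1\le p\le n-1$, $\ell\ge0$, $1\le j_1<\cdots<j_\ell\le n$, $1\le k_p\le d-1$. The set of canonical words is $\mathcal W(d,1,n)$. The left factor $s_{1i_1}\cdots s_{n-1,i_{n-1}}$ is the prefix and the right factor $s^{(k_1)}_{nj_1}\cdots s^{(k_\ell)}_{nj_\ell}$ is the suffix. Full commutativity: a reduced expression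 for $w$ is a word in the generators of minimal length representing $w$; $R(w)$ is the set of these. $w$ is fully commutative if any element of $R(w)$ can be obtained from any other using only the commutations $s_is_j=s_js_i$ $(j+1<i\le n)$ on adjacent letters. A canonical word is fully commutative if the element it represents is. Collections: for a suffix $\boldsymbol w'$, the collection $\mathbf c^n_{\boldsymbol w'}$ is the set of fully commutative words in $\mathcal W(d,1,n)$ whose suffix is $\boldsymbol w'$. Packets: $\mathcal P(n,k)$, $0\le k\le n$, is the following set of collections (all exponents $t,t_i$ range over $1,\dots,d-1$). $\mathcal P(n,0)$: collections labeled by suffixes $s^{(t_1)}_{n1}s^{(t_2)}_{nj_2}\cdots s^{(t_\ell)}_{nj_\ell}$ with $\ell\ge2$ and $1<j_2<\cdots<j_\ell\le n$. $\mathcal P(n,k)$ for $1\le k\le n-2$: collections labeled by $s^{(t)}_{nk}$ or by $s^{(t_1)}_{n,k+1}s^{(t_2)}_{nj_2}\cdots s^{(t_\ell)}_{nj_\ell}$ with $\ell\ge2$ and $k+1<j_2<\cdots<j_\ell\le n$. $\mathcal P(n,n-1)$: collections labeled by $s_n^t$ or $s^{(t)}_{n,n-1}=s_n^ts_{n-1}$. $\mathcal P(n,n)$: only the collection labeled by the empty suffix. *)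

theory Defs
  imports Complex_Main "HOL-Algebra.Group"
begin

section \<open>Groups given by generators and relations\<close>

text \<open>
  Signed words over a set \<open>S\<close> of generators: \<open>(a, True)\<close> stands for the generator \<open>a\<close> and
  \<open>(a, False)\<close> for its formal inverse.  All defining relations needed below are equations
  \<open>l = r\<close> between positive words, given as pairs \<open>(l, r)\<close>.
\<close>

definition signed_words :: "'a set \<Rightarrow> ('a \<times> bool) list set" where
  "signed_words S = lists (S \<times> UNIV)"

definition positive :: "'a list \<Rightarrow> ('a \<times> bool) list" where
  "positive w = map (\<lambda>a. (a, True)) w"

inductive pres_cong ::
  "'a set \<Rightarrow> ('a list \<times> 'a list) set \<Rightarrow> ('a \<times> bool) list \<Rightarrow> ('a \<times> bool) list \<Rightarrow> bool"
  for S :: "'a set" and Rel :: "('a list \<times> 'a list) set" where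
  refl: "u \<in> signed_words S \<Longrightarrow> pres_cong S Rel u u"
| sym: "pres_cong S Rel u v \<Longrightarrow> pres_cong S Rel v u"
| trans: "pres_cong S Rel u v \<Longrightarrow> pres_cong S Rel v w \<Longrightarrow> pres_cong S Rel u w"
| cancel: "x \<in> signed_words S \<Longrightarrow> y \<in> signed_words S \<Longrightarrow> a \<in> S \<Longrightarrow>
    pres_cong S Rel (x @ [(a, b), (a, \<not> b)] @ y) (x @ y)"
| relation: "x \<in> signed_words S \<Longrightarrow> y \<in> signed_words S \<Longrightarrow>
    (l, r) \<in> Rel \<Longrightarrow> l \<in> lists S \<Longrightarrow> r \<in> lists S \<Longrightarrow>
    pres_cong S Rel (x @ positive l @ y) (x @ positive r @ y)"

definition pres_class ::
  "'a set \<Rightarrow> ('a list \<times> 'a list) set \<Rightarrow> ('a \<times> bool) list \<Rightarrow> ('a \<times> bool) list set" where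
  "pres_class S Rel u = {v. pres_cong S Rel u v}"

definition presented_group ::
  "'a set \<Rightarrow> ('a list \<times> 'a list) set \<Rightarrow> ('a \<times> bool) list set monoid" where
  "presented_group S Rel =
    \<lparr> carrier = pres_class S Rel ` signed_words S,
      mult = (\<lambda>A B. \<Union>u\<in>A. \<Union>v\<in>B. pres_class S Rel (u @ v)),
      one = pres_class S Rel [] \<rparr>"

lemma pres_cong_signed_words:
  assumes "pres_cong S Rel u v"
  shows "u \<in> signed_words S \<and> v \<in> signed_words S"
  using assms by induction (auto simp: signed_words_def positive_def)

lemma pres_cong_context:
  assumes "pres_cong S Rel u v" "p \<in> signed_words S" "q \<in> signed_words S"
  shows "pres_cong S Rel (p @ u @ q) (p @ v @ q)"
  using assms
proof (induction arbitrary: p q)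
  case (refl u)
  then show ?case by (intro pres_cong.refl) (auto simp: signed_words_def)
next
  case (sym u v)
  then show ?case by (meson pres_cong.sym)
next
  case (trans u v w)
  then show ?case by (meson pres_cong.trans)
next
  case (cancel x y a b)
  then show ?case
    using pres_cong.cancel[of "p @ x" S "y @ q" a Rel b] by (simp add: signed_words_def)
next
  case (relation x y l r)
  then show ?case
    using pres_cong.relation[of "p @ x" S "y @ q" l r Rel] by (simp add: signed_words_def)
qed

lemma pres_cong_append:
  assumes "pres_cong S Rel u u'" "pres_cong S Rel v v'"
  shows "pres_cong S Rel (u @ v) (u' @ v')"
proof -
  have nil: "[] \<in> signed_words S" by (simp add: signed_words_def)
  have "pres_cong S Rel (u @ v) (u' @ v)"
    using pres_cong_context[OF assms(1) nil, of v] pres_cong_signed_words[OF assms(2)] by simp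
  moreover have "pres_cong S Rel (u' @ v) (u' @ v')"
    using pres_cong_context[OF assms(2) _ nil, of u'] pres_cong_signed_words[OF assms(1)] by simp
  ultimately show ?thesis by (rule pres_cong.trans)
qed

lemma pres_class_eq_iff:
  assumes "u \<in> signed_words S"
  shows "pres_class S Rel u = pres_class S Rel v \<longleftrightarrow> pres_cong S Rel u v"
proof
  assume "pres_class S Rel u = pres_class S Rel v"
  moreover have "u \<in> pres_class S Rel u"
    using assms by (simp add: pres_class_def pres_cong.refl)
  ultimately have "pres_cong S Rel v u"
    by (simp add: pres_class_def)
  then show "pres_cong S Rel u v"
    by (rule pres_cong.sym)
next
  assume uv: "pres_cong S Rel u v"
  have "pres_cong S Rel u w \<longleftrightarrow> pres_cong S Rel v w" for w
    using pres_cong.trans[OF uv] pres_cong.trans[OF pres_cong.sym[OF uv]] by blast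
  then show "pres_class S Rel u = pres_class S Rel v"
    by (simp add: pres_class_def)
qed

lemma presented_group_mult:
  assumes "u \<in> signed_words S" "v \<in> signed_words S"
  shows "pres_class S Rel u \<otimes>\<^bsub>presented_group S Rel\<^esub> pres_class S Rel v = pres_class S Rel (u @ v)"
proof -
  have eq: "pres_class S Rel (u' @ v') = pres_class S Rel (u @ v)"
    if "u' \<in> pres_class S Rel u" "v' \<in> pres_class S Rel v" for u' v'
  proof -
    have uv: "pres_cong S Rel (u @ v) (u' @ v')"
      using that by (simp add: pres_class_def pres_cong_append)
    then have "u @ v \<in> signed_words S"
      using pres_cong_signed_words by blast
    from pres_class_eq_iff[OF this] uv show ?thesis by metis
  qed
  have mem: "u \<in> pres_class S Rel u" "v \<in> pres_class S Rel v"
    using assms by (simp_all add: pres_class_def pres_cong.refl)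
  have "(\<Union>u'\<in>pres_class S Rel u. \<Union>v'\<in>pres_class S Rel v. pres_class S Rel (u' @ v'))
      = (\<Union>u'\<in>pres_class S Rel u. \<Union>v'\<in>pres_class S Rel v. pres_class S Rel (u @ v))"
    by (intro SUP_cong eq HOL.refl)
  also have "\<dots> = pres_class S Rel (u @ v)"
    using mem by blast
  finally show ?thesis
    by (simp add: presented_group_def)
qed

lemma group_presented_group: "group (presented_group S Rel)"
proof (rule groupI)
  let ?G = "presented_group S Rel"
  have carr: "carrier ?G = pres_class S Rel ` signed_words S"
    and one: "\<one>\<^bsub>?G\<^esub> = pres_class S Rel []"
    by (simp_all add: presented_group_def)
  have app: "u @ v \<in> signed_words S" if "u \<in> signed_words S" "v \<in> signed_words S" for u v
    using that by (simp add: signed_words_def)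
  have nil: "[] \<in> signed_words S" by (simp add: signed_words_def)
  show "x \<otimes>\<^bsub>?G\<^esub> y \<in> carrier ?G" if "x \<in> carrier ?G" "y \<in> carrier ?G" for x y
    using that by (auto simp: carr presented_group_mult app)
  show "\<one>\<^bsub>?G\<^esub> \<in> carrier ?G"
    using nil by (simp add: carr one)
  show "x \<otimes>\<^bsub>?G\<^esub> y \<otimes>\<^bsub>?G\<^esub> z = x \<otimes>\<^bsub>?G\<^esub> (y \<otimes>\<^bsub>?G\<^esub> z)"
    if "x \<in> carrier ?G" "y \<in> carrier ?G" "z \<in> carrier ?G" for x y z
    using that by (auto simp: carr presented_group_mult app)
  show "\<one>\<^bsub>?G\<^esub> \<otimes>\<^bsub>?G\<^esub> x = x" if "x \<in> carrier ?G" for x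
    using that nil by (auto simp: carr one presented_group_mult)
  show "\<exists>y\<in>carrier ?G. y \<otimes>\<^bsub>?G\<^esub> x = \<one>\<^bsub>?G\<^esub>" if x: "x \<in> carrier ?G" for x
  proof -
    obtain u where u: "u \<in> signed_words S" "x = pres_class S Rel u"
      using x by (auto simp: carr)
    have "\<exists>v\<in>signed_words S. pres_cong S Rel (v @ u) []"
      using u(1)
    proof (induction u)
      case Nil
      then show ?case by (intro bexI[of _ "[]"]) (simp_all add: pres_cong.refl signed_words_def)
    next
      case (Cons l u)
      obtain a b where l: "l = (a, b)" by fastforce
      with Cons.prems have a: "a \<in> S" and u: "u \<in> signed_words S"
        by (auto simp: signed_words_def)
      obtain v where v: "v \<in> signed_words S" "pres_cong S Rel (v @ u) []"
        using Cons.IH u by blast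
      have "pres_cong S Rel (v @ [(a, \<not> b), (a, b)] @ u) (v @ u)"
        using pres_cong.cancel[OF v(1) u a, of Rel "\<not> b"] by simp
      then have "pres_cong S Rel (v @ [(a, \<not> b), (a, b)] @ u) []"
        using v(2) by (rule pres_cong.trans)
      then have "pres_cong S Rel ((v @ [(a, \<not> b)]) @ l # u) []"
        using l by simp
      moreover have "v @ [(a, \<not> b)] \<in> signed_words S"
        using v(1) a by (simp add: signed_words_def)
      ultimately show ?case by blast
    qed
    then obtain v where v: "v \<in> signed_words S" "pres_cong S Rel (v @ u) []" by blast
    then have "pres_class S Rel v \<otimes>\<^bsub>?G\<^esub> x = \<one>\<^bsub>?G\<^esub>"
      using u by (simp add: one presented_group_mult pres_class_eq_iff app)
    then show ?thesis
      using v(1) by (auto simp: carr)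
  qed
qed


section \<open>The complex reflection group \<open>G(d,1,n)\<close>\<close>

text \<open>The generator \<open>s\<^sub>i\<close> is encoded by the natural number \<open>i \<in> {1..n}\<close>.\<close>

definition grel :: "nat \<Rightarrow> nat \<Rightarrow> (nat list \<times> nat list) set" where
  "grel d n =
     {(replicate d n, [])}
   \<union> {([i, i], []) | i. 1 \<le> i \<and> i < n}
   \<union> {([i, j], [j, i]) | i j. 1 \<le> j \<and> j + 1 < i \<and> i \<le> n}
   \<union> {([i + 1, i, i + 1], [i, i + 1, i]) | i. 1 \<le> i \<and> i + 2 \<le> n}
   \<union> (if 2 \<le> n then {([n, n - 1, n, n - 1], [n - 1, n, n - 1, n])} else {})"

definition G :: "nat \<Rightarrow> nat \<Rightarrow> (nat \<times> bool) list set monoid" where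
  "G d n = presented_group {1..n} (grel d n)"

definition gen :: "nat \<Rightarrow> nat \<Rightarrow> nat \<Rightarrow> (nat \<times> bool) list set" where
  "gen d n i = pres_class {1..n} (grel d n) [(i, True)]"

definition words :: "nat \<Rightarrow> nat list set" where
  "words n = lists {1..n}"

definition elt :: "nat \<Rightarrow> nat \<Rightarrow> nat list \<Rightarrow> (nat \<times> bool) list set" where
  "elt d n w = foldr (\<lambda>i x. gen d n i \<otimes>\<^bsub>G d n\<^esub> x) w \<one>\<^bsub>G d n\<^esub>"


section \<open>Full commutativity\<close>

definition reduced_words :: "nat \<Rightarrow> nat \<Rightarrow> (nat \<times> bool) list set \<Rightarrow> nat list set" where
  "reduced_words d n g =
    {u \<in> words n. elt d n u = g \<and> (\<forall>v \<in> words n. elt d n v = g \<longrightarrow> length u \<le> length v)}"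

definition comm_step :: "nat \<Rightarrow> (nat list \<times> nat list) set" where
  "comm_step n =
    {(x @ [i, j] @ y, x @ [j, i] @ y) | x y i j.
       x \<in> words n \<and> y \<in> words n \<and> i \<in> {1..n} \<and> j \<in> {1..n} \<and> (j + 1 < i \<or> i + 1 < j)}"

definition fully_commutative :: "nat \<Rightarrow> nat \<Rightarrow> (nat \<times> bool) list set \<Rightarrow> bool" where
  "fully_commutative d n g \<longleftrightarrow>
    (\<forall>u \<in> reduced_words d n g. \<forall>v \<in> reduced_words d n g. (u, v) \<in> (comm_step n)\<^sup>*)"


section \<open>Canonical words\<close>

text \<open>
  \<open>seg i j\<close> is the word \<open>s\<^sub>i s\<^sub>i\<^sub>-\<^sub>1 \<dots> s\<^sub>j\<close>, which is empty if \<open>i < j\<close>, and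
  \<open>ssup n k j\<close> is \<open>s\<^sub>n\<^sup>k\<close> followed by \<open>s\<^sub>n\<^sub>-\<^sub>1 \<dots> s\<^sub>j\<close>.
\<close>

definition seg :: "nat \<Rightarrow> nat \<Rightarrow> nat list" where
  "seg i j = rev [j..<Suc i]"

definition ssup :: "nat \<Rightarrow> nat \<Rightarrow> nat \<Rightarrow> nat list" where
  "ssup n k j = replicate k n @ seg (n - 1) j"

definition prefixes :: "nat \<Rightarrow> nat list set" where
  "prefixes n =
    {concat (map (\<lambda>p. seg p (i p)) [1..<n]) | i. \<forall>p \<in> {1..<n}. 1 \<le> i p \<and> i p \<le> p + 1}"

text \<open>
  A suffix is described by its list of pairs \<open>(k\<^sub>p, j\<^sub>p)\<close>, of an exponent and an index.
\<close>

definition suffix_data :: "nat \<Rightarrow> nat \<Rightarrow> (nat \<times> nat) list set" where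
  "suffix_data d n =
    {ps. (\<forall>(k, j) \<in> set ps. 1 \<le> k \<and> k \<le> d - 1 \<and> 1 \<le> j \<and> j \<le> n) \<and>
         sorted_wrt (<) (map snd ps)}"

definition suffix_word :: "nat \<Rightarrow> (nat \<times> nat) list \<Rightarrow> nat list" where
  "suffix_word n ps = concat (map (\<lambda>(k, j). ssup n k j) ps)"

definition canonical_words :: "nat \<Rightarrow> nat \<Rightarrow> nat list set" where
  "canonical_words d n = {p @ suffix_word n ps | p ps. p \<in> prefixes n \<and> ps \<in> suffix_data d n}"


section \<open>Collections and packets\<close>

text \<open>
  Prefixes do not contain the letter \<open>n\<close>, and a nonempty suffix begins with \<open>n\<close>; so for a suffix
  \<open>w'\<close>, the canonical words of the form \<open>p @ w'\<close> with \<open>p\<close> a prefix are those with suffix \<open>w'\<close>.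
\<close>

definition collection :: "nat \<Rightarrow> nat \<Rightarrow> nat list \<Rightarrow> nat list set" where
  "collection d n w' =
    {w \<in> canonical_words d n. (\<exists>p \<in> prefixes n. w = p @ w') \<and> fully_commutative d n (elt d n w)}"

definition packet_labels :: "nat \<Rightarrow> nat \<Rightarrow> nat \<Rightarrow> nat list set" where
  "packet_labels d n k =
    (if k = n then {[]}
     else if k = n - 1 then
       {suffix_word n [(t, j)] | t j. t \<in> {1..d - 1} \<and> (j = n \<or> j = n - 1)}
     else if k = 0 then
       {suffix_word n ((t, 1) # ps) | t ps. (t, 1) # ps \<in> suffix_data d n \<and> ps \<noteq> []}
     else
       {suffix_word n [(t, k)] | t. t \<in> {1..d - 1}} \<union>
       {suffix_word n ((t, k + 1) # ps) | t ps. (t, k + 1) # ps \<in> suffix_data d n \<and> ps \<noteq> []})"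

definition packet :: "nat \<Rightarrow> nat \<Rightarrow> nat \<Rightarrow> nat list set set" where
  "packet d n k = collection d n ` packet_labels d n k"

definition catalan_triangle :: "nat \<Rightarrow> nat \<Rightarrow> real" where
  "catalan_triangle n k = fact (n + k) * (real n - real k + 1) / (fact k * fact (n + 1))"

end

theory Submission
  imports Defs
begin

text \<open>
  Every word is turned into a canonical one by commutations, braids and steps that shorten it
  (\<open>word_to_canonical\<close>); besides the three-letter braids one uses the commutation of \<open>s\<^sub>n\<^sup>a\<close> with
  \<open>s\<^sub>n\<^sub>-\<^sub>1 s\<^sub>n\<^sup>b s\<^sub>n\<^sub>-\<^sub>1\<close>.  The action of the group on coloured positions separates canonical words
  (\<open>canonical_unique\<close>).  So a reduced word is joined to the canonical word of its element by
  commutations and braids alone, and a canonical word is fully commutative iff no word in its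
  commutation class contains a side of a braid (\<open>fully_commutative_iff\<close>).

  Now fix a suffix, and let \<open>i\<^sub>p\<close> be the lower ends of the nonempty segments of a prefix.  Unless they
  increase strictly, the prefix itself contains a braid up to commutation.  If they do, a segment
  whose lower end is at least the index \<open>j\<close> of the first block meets that block in a braid, with one
  exception: when there is a single block \<open>s\<^sub>n\<^sup>t s\<^sub>n\<^sub>-\<^sub>1 \<dots> s\<^sub>j\<close>, the prefix may end in a staircase
  \<open>s\<^sub>l s\<^sub>l\<^sub>+\<^sub>1 \<dots> s\<^sub>n\<^sub>-\<^sub>1\<close> with \<open>l \<ge> j\<close>, as \<open>s\<^sub>n\<^sub>-\<^sub>1 s\<^sub>n\<^sup>t s\<^sub>n\<^sub>-\<^sub>1\<close> is not a braid.  The remaining words are braid-free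
  because two properties survive commutations: the number of neighbours between equal letters and
  the subwords on two adjacent generators.

  Hence the admissible prefixes are those with increasing lower ends at most \<open>k\<close> for two or more
  blocks with \<open>j = k + 1\<close>, and those with lower ends below \<open>k\<close> followed by a staircase for one block
  with \<open>j = k\<close>; for \<open>j = n\<close>, as for the empty suffix, these are all prefixes with increasing lower
  ends.  Both families satisfy the recurrence \<open>C(m+1,k) = C(m,k) + C(m+1,k-1)\<close> of the Catalan
  triangle, which is why such different collections share a packet, and \<open>C(n,n) = C(n,n-1)\<close> accounts
  for \<open>j = n\<close>.
\<close>

section \<open>Words and the elements they represent\<close>

lemma words_simps [simp]:
  "[] \<in> words n"
  "a # w \<in> words n \<longleftrightarrow> 1 \<le> a \<and> a \<le> n \<and> w \<in> words n"
  "u @ v \<in> words n \<longleftrightarrow> u \<in> words n \<and> v \<in> words n"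
  "replicate k a \<in> words n \<longleftrightarrow> k = 0 \<or> (1 \<le> a \<and> a \<le> n)"
  by (auto simp: words_def in_lists_conv_set)

lemma positive_simps [simp]:
  "positive [] = []"
  "positive (a # w) = (a, True) # positive w"
  "positive (u @ v) = positive u @ positive v"
  by (simp_all add: positive_def)

lemma positive_signed_words: "w \<in> words n \<Longrightarrow> positive w \<in> signed_words {1..n}"
  by (auto simp: words_def positive_def signed_words_def)

lemma elt_eq_class:
  "w \<in> words n \<Longrightarrow> elt d n w = pres_class {1..n} (grel d n) (positive w)"
proof (induction w)
  case Nil
  then show ?case by (simp add: elt_def G_def presented_group_def)
next
  case (Cons a w)
  have "elt d n (a # w) = gen d n a \<otimes>\<^bsub>G d n\<^esub> elt d n w"
    by (simp add: elt_def)
  also have "\<dots> = pres_class {1..n} (grel d n) ([(a, True)] @ positive w)"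
    using Cons positive_signed_words[of w n]
    by (simp add: gen_def G_def, subst presented_group_mult)
       (auto simp: signed_words_def)
  finally show ?case by simp
qed

locale cyclotomic =
  fixes d n :: nat
  assumes d_pos: "1 \<le> d" and n_ge2: "2 \<le> n"
begin

definition eqv :: "nat list \<Rightarrow> nat list \<Rightarrow> bool" (infix "\<approx>" 50) where
  "u \<approx> v \<longleftrightarrow> u \<in> words n \<and> v \<in> words n \<and> elt d n u = elt d n v"

lemma eqv_iff_cong:
  "u \<approx> v \<longleftrightarrow> u \<in> words n \<and> v \<in> words n \<and> pres_cong {1..n} (grel d n) (positive u) (positive v)"
  unfolding eqv_def
  by (metis elt_eq_class pres_class_eq_iff positive_signed_words)

lemma eqv_refl: "u \<in> words n \<Longrightarrow> u \<approx> u"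
  by (simp add: eqv_def)

lemma eqv_sym: "u \<approx> v \<Longrightarrow> v \<approx> u"
  by (simp add: eqv_def)

lemma eqv_trans [trans]: "u \<approx> v \<Longrightarrow> v \<approx> w \<Longrightarrow> u \<approx> w"
  by (simp add: eqv_def)

lemma eqv_context: "u \<approx> v \<Longrightarrow> x \<in> words n \<Longrightarrow> y \<in> words n \<Longrightarrow> x @ u @ y \<approx> x @ v @ y"
  unfolding eqv_iff_cong positive_simps using positive_signed_words
  by (auto intro!: pres_cong_context simp del: One_nat_def)

lemma eqv_relation:
  assumes "(l, r) \<in> grel d n" "l \<in> words n" "r \<in> words n"
  shows "l \<approx> r"
  using pres_cong.relation[of "[]" "{1..n}" "[]" l r "grel d n"] assms
  by (simp add: eqv_iff_cong words_def signed_words_def)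

lemma eqv_square: "1 \<le> i \<Longrightarrow> i < n \<Longrightarrow> [i, i] \<approx> []"
  by (rule eqv_relation) (auto simp: grel_def)

lemma eqv_power: "replicate d n \<approx> []"
  using n_ge2 by (intro eqv_relation) (auto simp: grel_def)

lemma eqv_commute:
  assumes "1 \<le> i" "i \<le> n" "1 \<le> j" "j \<le> n" "j + 1 < i \<or> i + 1 < j"
  shows "[i, j] \<approx> [j, i]"
proof -
  have *: "[i, j] \<approx> [j, i]" if "1 \<le> j" "j + 1 < i" "i \<le> n" for i j
    using that by (intro eqv_relation) (auto simp: grel_def)
  show ?thesis using assms *[of j i] *[of i j] eqv_sym by blast
qed

lemma eqv_braid3:
  assumes "1 \<le> i" "i < n" "1 \<le> j" "j < n" "i = j + 1 \<or> j = i + 1"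
  shows "[i, j, i] \<approx> [j, i, j]"
proof -
  have *: "[i + 1, i, i + 1] \<approx> [i, i + 1, i]" if "1 \<le> i" "i + 1 < n" for i
    using that by (intro eqv_relation) (auto simp: grel_def)
  show ?thesis using assms *[of j] *[of i] eqv_sym by blast
qed

text \<open>
  Since \<open>s\<^sub>n\<^sub>-\<^sub>1 s\<^sub>n\<^sup>b s\<^sub>n\<^sub>-\<^sub>1\<close> is the \<open>b\<close>-th power of \<open>s\<^sub>n\<^sub>-\<^sub>1 s\<^sub>n s\<^sub>n\<^sub>-\<^sub>1\<close>, it commutes with
  whatever the latter commutes with, and the defining relation of length four says that this
  includes \<open>s\<^sub>n\<close>.  The powers are multiplied out by inserting the square of \<open>s\<^sub>n\<^sub>-\<^sub>1\<close>.
\<close>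

lemma eqv_braid4_step:
  "[n, n - 1] @ replicate b n @ [n - 1] \<approx> [n - 1] @ replicate b n @ [n - 1, n]"
proof (induction b)
  case 0
  have sq: "[n - 1, n - 1] \<approx> []" using n_ge2 by (intro eqv_square) auto
  have "[n, n - 1, n - 1] \<approx> [n]" using eqv_context[OF sq, of "[n]" "[]"] n_ge2 by simp
  also have "[n] \<approx> [n - 1, n - 1, n]"
    using eqv_sym[OF eqv_context[OF sq, of "[]" "[n]"]] n_ge2 by simp
  finally show ?case by simp
next
  case (Suc b)
  let ?r = "replicate b n"
  have sq: "[n - 1, n - 1] \<approx> []" using n_ge2 by (intro eqv_square) auto
  have br: "[n, n - 1, n, n - 1] \<approx> [n - 1, n, n - 1, n]"
    using n_ge2 by (intro eqv_relation) (auto simp: grel_def)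
  have "[n, n - 1, n] @ ?r @ [n - 1] \<approx> [n, n - 1, n] @ [n - 1, n - 1] @ (?r @ [n - 1])"
    using eqv_sym[OF eqv_context[OF sq, of "[n, n - 1, n]" "?r @ [n - 1]"]] n_ge2 by simp
  also have "\<dots> \<approx> [n - 1, n, n - 1, n] @ ([n - 1] @ ?r @ [n - 1])"
    using eqv_context[OF br, of "[]" "[n - 1] @ ?r @ [n - 1]"] n_ge2 by simp
  also have "\<dots> \<approx> [n - 1, n, n - 1] @ ([n - 1] @ ?r @ [n - 1, n]) @ []"
    using eqv_context[OF Suc.IH, of "[n - 1, n, n - 1]" "[]"] n_ge2 by simp
  also have "\<dots> \<approx> [n - 1, n] @ [] @ (?r @ [n - 1, n])"
    using eqv_context[OF sq, of "[n - 1, n]" "?r @ [n - 1, n]"] n_ge2 by simp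
  finally show ?case by simp
qed

lemma eqv_braid4:
  "replicate a n @ [n - 1] @ replicate b n @ [n - 1] \<approx> [n - 1] @ replicate b n @ [n - 1] @ replicate a n"
proof (induction a)
  case 0
  then show ?case using n_ge2 by (simp add: eqv_refl)
next
  case (Suc a)
  let ?r = "[n - 1] @ replicate b n @ [n - 1]"
  have "[n] @ (replicate a n @ ?r) @ [] \<approx> [n] @ (?r @ replicate a n) @ []"
    using Suc.IH n_ge2 by (intro eqv_context) auto
  also have "[n] @ (?r @ replicate a n) @ [] \<approx> [] @ ([n - 1] @ replicate b n @ [n - 1, n]) @ replicate a n"
    using eqv_context[OF eqv_braid4_step[of b], of "[]" "replicate a n"] n_ge2 by simp
  finally show ?case by simp
qed

section \<open>Length-preserving moves\<close>

text \<open>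
  Besides the three-letter braids, the length-preserving relations include the commutation of
  \<open>s\<^sub>n\<^sup>a\<close> with \<open>s\<^sub>n\<^sub>-\<^sub>1 s\<^sub>n\<^sup>b s\<^sub>n\<^sub>-\<^sub>1\<close> for all exponents.  The defining relation is the case \<open>a = b = 1\<close>;
  deriving the others from it passes through longer words.  For \<open>d > 2\<close> that case alone does not
  connect all reduced words of an element: it applies nowhere in \<open>s\<^sub>n\<^sup>2 s\<^sub>n\<^sub>-\<^sub>1 s\<^sub>n\<^sup>2 s\<^sub>n\<^sub>-\<^sub>1\<close>.
\<close>

inductive braid :: "nat list \<Rightarrow> nat list \<Rightarrow> bool" where
  three: "\<lbrakk>1 \<le> i; i < n; 1 \<le> j; j < n; i = j + 1 \<or> j = i + 1\<rbrakk> \<Longrightarrow> braid [i, j, i] [j, i, j]"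
| four: "\<lbrakk>1 \<le> a; 1 \<le> b\<rbrakk> \<Longrightarrow>
    braid (replicate a n @ [n - 1] @ replicate b n @ [n - 1])
          ([n - 1] @ replicate b n @ [n - 1] @ replicate a n)"
| four_rev: "\<lbrakk>1 \<le> a; 1 \<le> b\<rbrakk> \<Longrightarrow>
    braid ([n - 1] @ replicate b n @ [n - 1] @ replicate a n)
          (replicate a n @ [n - 1] @ replicate b n @ [n - 1])"

definition braid_step :: "(nat list \<times> nat list) set" where
  "braid_step = {(x @ l @ y, x @ r @ y) | x y l r. x \<in> words n \<and> y \<in> words n \<and> braid l r}"

definition comm_equiv :: "nat list \<Rightarrow> nat list \<Rightarrow> bool" (infix "\<sim>" 50) where
  "u \<sim> v \<longleftrightarrow> (u, v) \<in> (comm_step n)\<^sup>*"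

definition move_equiv :: "nat list \<Rightarrow> nat list \<Rightarrow> bool" (infix "\<simeq>" 50) where
  "u \<simeq> v \<longleftrightarrow> (u, v) \<in> (comm_step n \<union> braid_step)\<^sup>*"

lemma braid_eqv: "braid l r \<Longrightarrow> l \<approx> r"
  by (induction rule: braid.induct) (use eqv_braid3 eqv_braid4 eqv_sym in \<open>auto\<close>)

lemma braid_sym: "braid l r \<Longrightarrow> braid r l"
  by (induction rule: braid.induct) (blast intro: braid.intros)+

lemma braid_length: "braid l r \<Longrightarrow> length l = length r"
  by (induction rule: braid.induct) auto

lemma comm_step_sym: "sym (comm_step n)"
  unfolding sym_def comm_step_def by blast

lemma braid_step_sym: "sym braid_step"
  unfolding sym_def braid_step_def using braid_sym by blast

lemma move_refl [simp]: "u \<simeq> u"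
  by (simp add: move_equiv_def)

lemma comm_refl [simp]: "u \<sim> u"
  by (simp add: comm_equiv_def)

lemma move_sym: "u \<simeq> v \<Longrightarrow> v \<simeq> u"
  unfolding move_equiv_def by (meson comm_step_sym braid_step_sym sym_Un sym_rtrancl symD)

lemma comm_sym: "u \<sim> v \<Longrightarrow> v \<sim> u"
  unfolding comm_equiv_def by (meson comm_step_sym sym_rtrancl symD)

lemma move_trans [trans]: "u \<simeq> v \<Longrightarrow> v \<simeq> w \<Longrightarrow> u \<simeq> w"
  unfolding move_equiv_def by (rule rtrancl_trans)

lemma comm_trans [trans]: "u \<sim> v \<Longrightarrow> v \<sim> w \<Longrightarrow> u \<sim> w"
  unfolding comm_equiv_def by (rule rtrancl_trans)

lemma comm_imp_move: "u \<sim> v \<Longrightarrow> u \<simeq> v"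
  unfolding comm_equiv_def move_equiv_def by (meson Un_upper1 rtrancl_mono subsetD)

lemma comm_step_context:
  "(u, v) \<in> comm_step n \<Longrightarrow> x \<in> words n \<Longrightarrow> y \<in> words n \<Longrightarrow> (x @ u @ y, x @ v @ y) \<in> comm_step n"
  unfolding comm_step_def mem_Collect_eq
  by (elim exE conjE, rename_tac a b i j, rule_tac x = "x @ a" in exI, rule_tac x = "b @ y" in exI)
     auto

lemma braid_step_context:
  "(u, v) \<in> braid_step \<Longrightarrow> x \<in> words n \<Longrightarrow> y \<in> words n \<Longrightarrow> (x @ u @ y, x @ v @ y) \<in> braid_step"
  unfolding braid_step_def mem_Collect_eq
  by (elim exE conjE, rename_tac a b l r, rule_tac x = "x @ a" in exI, rule_tac x = "b @ y" in exI)
     auto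

lemma comm_context:
  assumes "u \<sim> v" "x \<in> words n" "y \<in> words n"
  shows "x @ u @ y \<sim> x @ v @ y"
  using assms(1) unfolding comm_equiv_def
proof (induction rule: rtrancl_induct)
  case (step v w)
  then show ?case using comm_step_context[OF step(2) assms(2,3)] by (meson rtrancl.rtrancl_into_rtrancl)
qed simp

lemma move_context:
  assumes "u \<simeq> v" "x \<in> words n" "y \<in> words n"
  shows "x @ u @ y \<simeq> x @ v @ y"
  using assms(1) unfolding move_equiv_def
proof (induction rule: rtrancl_induct)
  case (step v w)
  have "(x @ v @ y, x @ w @ y) \<in> comm_step n \<union> braid_step"
    using step(2) comm_step_context[OF _ assms(2,3)] braid_step_context[OF _ assms(2,3)] by blast
  with step.IH show ?case by (rule rtrancl.rtrancl_into_rtrancl)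
qed simp

lemma move_step_eqv: "(u, v) \<in> comm_step n \<union> braid_step \<Longrightarrow> u \<approx> v \<and> length u = length v"
proof (elim UnE)
  assume "(u, v) \<in> comm_step n"
  then obtain x y i j where *: "u = x @ [i, j] @ y" "v = x @ [j, i] @ y" "x \<in> words n" "y \<in> words n"
      "i \<in> {1..n}" "j \<in> {1..n}" "j + 1 < i \<or> i + 1 < j"
    unfolding comm_step_def by blast
  then show ?thesis using eqv_context[OF eqv_commute[of i j], of x y] by auto
next
  assume "(u, v) \<in> braid_step"
  then obtain x y l r where *: "u = x @ l @ y" "v = x @ r @ y" "x \<in> words n" "y \<in> words n" "braid l r"
    unfolding braid_step_def by blast
  then show ?thesis using eqv_context[OF braid_eqv[of l r], of x y] braid_length[of l r] by auto
qed

lemma move_eqv: "u \<simeq> v \<Longrightarrow> u \<in> words n \<Longrightarrow> u \<approx> v \<and> length u = length v"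
  unfolding move_equiv_def
proof (induction rule: rtrancl_induct)
  case (step v w)
  then show ?case using move_step_eqv[OF step(2)] eqv_trans by auto
qed (simp add: eqv_refl)

lemma letter_word_commute:
  assumes "1 \<le> a" "a \<le> n" "v \<in> words n" "\<forall>b \<in> set v. a + 1 < b \<or> b + 1 < a"
  shows "[a] @ v \<sim> v @ [a]"
  using assms(3,4)
proof (induction v)
  case (Cons b v)
  have "([] @ [a, b] @ v, [] @ [b, a] @ v) \<in> comm_step n"
    unfolding comm_step_def mem_Collect_eq using Cons.prems assms(1,2)
    by (intro exI[of _ "[]"] exI[of _ v] exI[of _ a] exI[of _ b]) auto
  then have "[a] @ b # v \<sim> [b] @ ([a] @ v) @ []" by (auto simp: comm_equiv_def)
  also have "\<dots> \<sim> [b] @ (v @ [a]) @ []"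
    using Cons assms by (intro comm_context) auto
  finally show ?case by simp
qed simp

lemma word_word_commute:
  assumes "u \<in> words n" "v \<in> words n" "\<forall>a \<in> set u. \<forall>b \<in> set v. a + 1 < b \<or> b + 1 < a"
  shows "u @ v \<sim> v @ u"
  using assms(1,3)
proof (induction u)
  case (Cons a u)
  have "(a # u) @ v \<sim> [a] @ (v @ u) @ []"
    using comm_context[of "u @ v" "v @ u" "[a]" "[]"] Cons assms by simp
  also have "\<dots> \<sim> [] @ (v @ [a]) @ u"
    using comm_context[OF letter_word_commute[of a v], of "[]" u] Cons assms by simp
  finally show ?case by simp
qed simp

end

section \<open>Reduction to canonical words\<close>

lemma seg_empty [simp]: "m < j \<Longrightarrow> seg m j = []"
  by (simp add: seg_def)

lemma seg_Suc: "j \<le> Suc m \<Longrightarrow> seg (Suc m) j = Suc m # seg m j"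
  by (simp add: seg_def)

lemma seg_snoc: "j \<le> m \<Longrightarrow> seg m j = seg m (Suc j) @ [j]"
  by (simp add: seg_def upt_conv_Cons)

lemma seg_split: "1 \<le> j \<Longrightarrow> j \<le> i \<Longrightarrow> i \<le> Suc m \<Longrightarrow> seg m j = seg m i @ seg (i - 1) j"
proof -
  assume "1 \<le> j" "j \<le> i" "i \<le> Suc m"
  then have "[j..<Suc m] = [j..<i] @ [i..<Suc m]"
    using upt_add_eq_append[of j i "Suc m - i"] by simp
  moreover have "[j..<i] = [j..<Suc (i - 1)]" using \<open>1 \<le> j\<close> \<open>j \<le> i\<close> by (cases i) auto
  ultimately show ?thesis by (simp add: seg_def del: upt_Suc)
qed

lemma set_seg [simp]: "set (seg m j) = {j..m}"
  by (auto simp: seg_def)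

lemma seg_self [simp]: "seg m m = [m]"
  by (simp add: seg_def)

lemma seg_in_words: "1 \<le> j \<Longrightarrow> m \<le> n \<Longrightarrow> seg m j \<in> words n"
  by (auto simp: words_def in_lists_conv_set)

lemma ssup_in_words: "1 \<le> j \<Longrightarrow> 1 \<le> n \<Longrightarrow> ssup n k j \<in> words n"
  by (simp add: ssup_def seg_in_words)

lemma ssup_snoc: "1 \<le> j \<Longrightarrow> j < n \<Longrightarrow> ssup n k j = ssup n k (Suc j) @ [j]"
  using seg_snoc[of j "n - 1"] by (auto simp: ssup_def)

lemma suffix_word_simps [simp]:
  "suffix_word n [] = []"
  "suffix_word n ((k, j) # ps) = ssup n k j @ suffix_word n ps"
  "suffix_word n (ps @ qs) = suffix_word n ps @ suffix_word n qs"
  by (simp_all add: suffix_word_def)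

lemma suffix_data_Nil [simp]: "[] \<in> suffix_data d n"
  by (simp add: suffix_data_def)

lemma suffix_data_Cons [simp]:
  "(k, j) # ps \<in> suffix_data d n \<longleftrightarrow>
     1 \<le> k \<and> k \<le> d - 1 \<and> 1 \<le> j \<and> j \<le> n \<and> ps \<in> suffix_data d n \<and> (\<forall>(k', j') \<in> set ps. j < j')"
  by (auto simp: suffix_data_def)

lemma suffix_data_append:
  "ps @ qs \<in> suffix_data d n \<longleftrightarrow> ps \<in> suffix_data d n \<and> qs \<in> suffix_data d n \<and>
     (\<forall>j \<in> snd ` set ps. \<forall>j' \<in> snd ` set qs. j < j')"
  by (auto simp: suffix_data_def sorted_wrt_append)

lemma suffix_in_words: "1 \<le> n \<Longrightarrow> ps \<in> suffix_data d n \<Longrightarrow> suffix_word n ps \<in> words n"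
  by (induction ps) (auto simp: ssup_in_words)

text \<open>
  A form of \<^const>\<open>prefixes\<close> that allows induction on the number of segments; the segment of level 0
  is empty.
\<close>

fun prefix_words :: "nat \<Rightarrow> nat list set" where
  "prefix_words 0 = {[]}"
| "prefix_words (Suc m) = {p @ seg m i | p i. p \<in> prefix_words m \<and> 1 \<le> i \<and> i \<le> Suc m}"

lemma prefix_words_SucI:
  "\<lbrakk>p \<in> prefix_words m; 1 \<le> i; i \<le> Suc m\<rbrakk> \<Longrightarrow> p @ seg m i \<in> prefix_words (Suc m)"
  by auto

lemma prefixes_eq: "prefixes n = prefix_words n"
proof (induction n)
  case 0
  then show ?case by (simp add: prefixes_def)
next
  case (Suc m)
  show ?case
  proof (cases "m = 0")
    case True
    have "seg 0 (Suc 0) = []" by simp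
    then have "prefix_words (Suc 0) = {[]}" by (auto, metis le_refl)
    then show ?thesis using True by (auto simp: prefixes_def)
  next
    case False
    then have upt: "[1..<Suc m] = [1..<m] @ [m]" by simp
    show ?thesis
    proof (intro subset_antisym subsetI)
      fix w assume "w \<in> prefixes (Suc m)"
      then obtain i where i: "\<forall>p \<in> {1..<Suc m}. 1 \<le> i p \<and> i p \<le> p + 1"
        "w = concat (map (\<lambda>p. seg p (i p)) [1..<Suc m])"
        unfolding prefixes_def by blast
      have "concat (map (\<lambda>p. seg p (i p)) [1..<m]) \<in> prefixes m"
        unfolding prefixes_def using i(1) by fastforce
      moreover have "1 \<le> i m" "i m \<le> Suc m" using i(1) False by auto
      ultimately show "w \<in> prefix_words (Suc m)"
        unfolding prefix_words.simps using i(2) Suc.IH upt by auto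
    next
      fix w assume "w \<in> prefix_words (Suc m)"
      then obtain p j where pj: "p \<in> prefixes m" "1 \<le> j" "j \<le> Suc m" "w = p @ seg m j"
        using Suc.IH by auto
      then obtain i where i: "\<forall>p \<in> {1..<m}. 1 \<le> i p \<and> i p \<le> p + 1"
        "p = concat (map (\<lambda>p. seg p (i p)) [1..<m])"
        unfolding prefixes_def by blast
      have "p = concat (map (\<lambda>p. seg p ((i(m := j)) p)) [1..<m])"
        unfolding i(2) by (intro arg_cong[where f = concat] map_cong) auto
      then have "w = concat (map (\<lambda>p. seg p ((i(m := j)) p)) [1..<Suc m])"
        using upt pj(4) by simp
      moreover have "\<forall>p \<in> {1..<Suc m}. 1 \<le> (i(m := j)) p \<and> (i(m := j)) p \<le> p + 1"
        using i(1) pj by auto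
      ultimately show "w \<in> prefixes (Suc m)" unfolding prefixes_def by blast
    qed
  qed
qed

lemma set_prefix_words: "p \<in> prefix_words m \<Longrightarrow> set p \<subseteq> {1..<m}"
  by (induction m arbitrary: p) fastforce+

lemma prefix_words_in_words: "p \<in> prefix_words m \<Longrightarrow> m \<le> Suc n \<Longrightarrow> p \<in> words n"
  using set_prefix_words[of p m] by (fastforce simp: words_def in_lists_conv_set)

context cyclotomic
begin

text \<open>
  The second outcome, besides length-preserving moves, of a step in the reduction to canonical form.
  It cannot occur for a reduced word, so the process need not be continued from the shorter word.
\<close>

definition shortens :: "nat list \<Rightarrow> bool" where
  "shortens u \<longleftrightarrow> (\<exists>v. v \<approx> u \<and> length v < length u)"

lemma shortens_context: "shortens u \<Longrightarrow> x \<in> words n \<Longrightarrow> y \<in> words n \<Longrightarrow> shortens (x @ u @ y)"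
  unfolding shortens_def using eqv_context by (metis length_append nat_add_left_cancel_less add_less_cancel_right)

lemma shortens_move: "u \<simeq> v \<Longrightarrow> u \<in> words n \<Longrightarrow> shortens v \<Longrightarrow> shortens u"
  unfolding shortens_def using move_eqv[of u v] eqv_trans eqv_sym by metis

lemma shortens_square: "1 \<le> i \<Longrightarrow> i < n \<Longrightarrow> shortens [i, i]"
  unfolding shortens_def using eqv_sym[OF eqv_square] by (intro exI[of _ "[]"]) auto

lemma braid_imp_move:
  assumes "braid l r"
  shows "l \<simeq> r"
proof -
  have "([] @ l @ [], [] @ r @ []) \<in> braid_step"
    unfolding braid_step_def mem_Collect_eq using assms
    by (intro exI[of _ "[]"] exI[of _ l] exI[of _ r]) simp
  then show ?thesis unfolding move_equiv_def by auto
qed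

lemma braid3_move:
  "\<lbrakk>1 \<le> i; i < n; 1 \<le> j; j < n; i = j + 1 \<or> j = i + 1\<rbrakk> \<Longrightarrow> [i, j, i] \<simeq> [j, i, j]"
  using braid_imp_move[OF braid.three[of i j]] by simp

lemma braid4_move:
  "\<lbrakk>1 \<le> a; 1 \<le> b\<rbrakk> \<Longrightarrow>
    replicate a n @ [n - 1] @ replicate b n @ [n - 1] \<simeq> [n - 1] @ replicate b n @ [n - 1] @ replicate a n"
  by (rule braid_imp_move[OF braid.four])

text \<open>
  The letter \<open>a\<close> travels left up to \<open>s\<^sub>a s\<^sub>a\<^sub>-\<^sub>1\<close>, a braid turns it into \<open>a - 1\<close>, and that letter commutes
  with the remaining ones, all larger than \<open>a\<close>.
\<close>

lemma seg_push:
  assumes "1 \<le> j" "j < a" "a \<le> m" "m < n"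
  shows "seg m j @ [a] \<simeq> [a - 1] @ seg m j"
proof -
  have *: "seg m j = seg m (a + 1) @ [a, a - 1] @ seg (a - 2) j"
  proof -
    have "seg m j = seg m (a + 1) @ seg a j" using seg_split[of j "a + 1" m] assms by simp
    also have "seg a j = a # seg (a - 1) j" using seg_Suc[of j "a - 1"] assms by simp
    also have "seg (a - 1) j = (a - 1) # seg (a - 2) j"
      using seg_Suc[of j "a - 2"] assms by (simp add: numeral_2_eq_2 Suc_diff_Suc)
    finally show ?thesis by simp
  qed
  let ?x = "seg m (a + 1)" and ?y = "seg (a - 2) j"
  have xw: "?x \<in> words n" and yw: "?y \<in> words n"
    using assms by (auto intro!: seg_in_words)
  have "seg m j @ [a] = (?x @ [a, a - 1]) @ (?y @ [a]) @ []" using * by simp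
  also have "\<dots> \<simeq> (?x @ [a, a - 1]) @ ([a] @ ?y) @ []"
    using assms xw yw
    by (intro move_context comm_imp_move[OF comm_sym] letter_word_commute) auto
  also have "\<dots> = ?x @ [a, a - 1, a] @ ?y" by simp
  also have "\<dots> \<simeq> ?x @ [a - 1, a, a - 1] @ ?y"
    using assms xw yw by (intro move_context braid3_move) auto
  also have "\<dots> = [] @ (?x @ [a - 1]) @ ([a, a - 1] @ ?y)" by simp
  also have "\<dots> \<simeq> [] @ ([a - 1] @ ?x) @ ([a, a - 1] @ ?y)"
    using assms xw yw
    by (intro move_context comm_imp_move[OF comm_sym] letter_word_commute) auto
  finally show ?thesis using * by simp
qed

lemma seg_letter_commute:
  assumes "1 \<le> a" "a + 1 < j" "m \<le> n" "a \<le> n"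
  shows "seg m j @ [a] \<simeq> [a] @ seg m j"
  using assms by (intro comm_imp_move[OF comm_sym] letter_word_commute) (auto intro!: seg_in_words)

text \<open>
  Compare \<open>a\<close> with the lower end \<open>i\<close> of the last segment: \<open>a = i - 1\<close> extends the segment,
  \<open>a = i\<close> cancels, and in all other cases a letter crosses the segment to the left, where the
  prefix has one level less.
\<close>

lemma prefix_times_letter:
  assumes "p \<in> prefix_words m" "m \<le> n" "1 \<le> a" "a < m"
  shows "(\<exists>q \<in> prefix_words m. p @ [a] \<simeq> q) \<or> shortens (p @ [a])"
  using assms
proof (induction m arbitrary: p a)
  case (Suc m)
  obtain q i where q: "q \<in> prefix_words m" "1 \<le> i" "i \<le> Suc m" "p = q @ seg m i"
    using Suc.prems(1) by auto
  have w: "q \<in> words n" "seg m i \<in> words n" "[a] \<in> words n"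
    using prefix_words_in_words[OF q(1)] Suc.prems q by (auto intro!: seg_in_words)
  \<comment> \<open>a letter that leaves the last segment on its left is absorbed by the shorter prefix\<close>
  have push: ?case if b: "seg m i @ [a] \<simeq> [b] @ seg m i" "1 \<le> b" "b < m" for b
  proof -
    have m1: "p @ [a] \<simeq> q @ [b] @ seg m i"
      using move_context[OF b(1), of q "[]"] q(4) w by simp
    consider (canonical) q' where "q' \<in> prefix_words m" "q @ [b] \<simeq> q'" | (short) "shortens (q @ [b])"
      using Suc.IH[OF q(1), of b] Suc.prems(2) b by auto
    then show ?case
    proof cases
      case canonical
      have "q @ [b] @ seg m i \<simeq> q' @ seg m i"
        using move_context[OF canonical(2), of "[]" "seg m i"] w by simp
      with m1 have "p @ [a] \<simeq> q' @ seg m i" by (rule move_trans)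
      moreover have "q' @ seg m i \<in> prefix_words (Suc m)" using canonical q by auto
      ultimately show ?thesis by blast
    next
      case short
      then have "shortens (q @ [b] @ seg m i)"
        using shortens_context[of "q @ [b]" "[]" "seg m i"] w by simp
      with shortens_move[OF m1] w q show ?thesis by auto
    qed
  qed
  consider "a + 1 < i" | "a + 1 = i" | "a = i" | "i < a" by linarith
  then show ?case
  proof cases
    case 1
    with Suc.prems q show ?thesis by (intro push[of a] seg_letter_commute) auto
  next
    case 2
    then have "p @ [a] = q @ seg m a" using q Suc.prems seg_snoc[of a m] by simp
    moreover have "\<dots> \<in> prefix_words (Suc m)"
      using q(1) Suc.prems by (intro prefix_words_SucI) auto
    ultimately have "p @ [a] \<in> prefix_words (Suc m)" by (rule ssubst)
    then show ?thesis using move_refl by blast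
  next
    case 3
    then have "p @ [a] = (q @ seg m (Suc i)) @ [a, a] @ []"
      using q Suc.prems seg_snoc[of i m] by simp
    moreover have "shortens [a, a]" using Suc.prems by (intro shortens_square) auto
    moreover have "seg m (Suc i) \<in> words n" using Suc.prems by (intro seg_in_words) auto
    ultimately show ?thesis using shortens_context[of "[a, a]" "q @ seg m (Suc i)" "[]"] w by auto
  next
    case 4
    then show ?thesis using Suc.prems q by (intro push[of "a - 1"] seg_push) auto
  qed
qed simp

lemma seg_seg_swap_aux:
  assumes "1 \<le> j" "j \<le> i" "i \<le> m" "m < n"
  shows "seg m j @ seg i (j + 1) \<simeq> seg (i - 1) j @ seg m j"
  using assms(2,3)
proof (induction i rule: dec_induct)
  case base
  then show ?case using assms by simp
next
  case (step i)
  have w: "seg m j \<in> words n" "seg i (j + 1) \<in> words n" "[i] \<in> words n"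
    using assms step by (auto intro!: seg_in_words)
  have "seg m j @ seg (Suc i) (j + 1) = [] @ (seg m j @ [Suc i]) @ seg i (j + 1)"
    using step by (simp add: seg_Suc)
  also have "\<dots> \<simeq> [] @ ([Suc i - 1] @ seg m j) @ seg i (j + 1)"
    using assms step w by (intro move_context seg_push) auto
  also have "\<dots> = [i] @ (seg m j @ seg i (j + 1)) @ []" by simp
  also have "\<dots> \<simeq> [i] @ (seg (i - 1) j @ seg m j) @ []"
    using step w by (intro move_context) auto
  also have "\<dots> = seg i j @ seg m j"
    using assms step seg_Suc[of j "i - 1"] by simp
  finally show ?case by simp
qed

lemma seg_seg_swap:
  "\<lbrakk>1 \<le> j; j \<le> m; m < n\<rbrakk> \<Longrightarrow> seg (m - 1) j @ seg m j \<simeq> seg m j @ seg m (j + 1)"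
  by (rule move_sym, rule seg_seg_swap_aux) auto

lemma power_word_commute:
  assumes "v \<in> words n" "\<forall>b \<in> set v. b + 1 < n"
  shows "replicate k n @ v \<simeq> v @ replicate k n"
  using assms n_ge2 by (intro comm_imp_move word_word_commute) auto

lemma ssup_unfold: "j < n \<Longrightarrow> ssup n k j = replicate k n @ [n - 1] @ seg (n - 2) j"
  using seg_Suc[of j "n - 2"] n_ge2 by (simp add: ssup_def numeral_2_eq_2 Suc_diff_Suc)

text \<open>
  The case that would create two blocks with the same index: \<open>s\<^sub>n\<^sup>l s\<^sub>n\<^sub>-\<^sub>1 s\<^sub>n\<^sup>k s\<^sub>n\<^sub>-\<^sub>1\<close> is uncovered by
  commutations, a braid exchanges the exponents, and one letter \<open>s\<^sub>n\<^sub>-\<^sub>1\<close> comes out on the left.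
\<close>

lemma block_swap:
  assumes "1 \<le> j" "j < n" "1 \<le> k" "1 \<le> l"
  shows "ssup n l j @ ssup n k j \<simeq> [n - 1] @ ssup n k j @ ssup n l (j + 1)"
proof -
  let ?l = "replicate l n" and ?k = "replicate k n" and ?s = "seg (n - 2) j" and ?t = "seg (n - 1) (j + 1)"
  have w: "?s \<in> words n" "?t \<in> words n" "seg (n - 1) j \<in> words n" "[n - 1] \<in> words n" "[n] \<in> words n"
    using assms n_ge2 by (auto intro!: seg_in_words)
  have small: "\<forall>b \<in> set ?s. b + 1 < n" using n_ge2 by auto
  have "ssup n l j @ ssup n k j = (?l @ [n - 1]) @ (?s @ ?k) @ seg (n - 1) j"
    using ssup_unfold[OF assms(2), of l] by (simp add: ssup_def)
  also have "\<dots> \<simeq> (?l @ [n - 1]) @ (?k @ ?s) @ seg (n - 1) j"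
    using w small by (intro move_context move_sym[OF power_word_commute]) auto
  also have "\<dots> = (?l @ [n - 1] @ ?k) @ (?s @ seg (n - 1) j) @ []" by simp
  also have "\<dots> \<simeq> (?l @ [n - 1] @ ?k) @ (seg (n - 1) j @ ?t) @ []"
    using w seg_seg_swap[of j "n - 1"] assms n_ge2
    by (intro move_context) (auto simp: numeral_2_eq_2)
  also have "\<dots> = [] @ (?l @ [n - 1] @ ?k @ [n - 1]) @ (?s @ ?t)"
    using ssup_unfold[OF assms(2), of 0] by (simp add: ssup_def)
  also have "\<dots> \<simeq> [] @ ([n - 1] @ ?k @ [n - 1] @ ?l) @ (?s @ ?t)"
    using w assms by (intro move_context braid4_move) auto
  also have "\<dots> = ([n - 1] @ ?k @ [n - 1]) @ (?l @ ?s) @ ?t" by simp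
  also have "\<dots> \<simeq> ([n - 1] @ ?k @ [n - 1]) @ (?s @ ?l) @ ?t"
    using w small by (intro move_context power_word_commute) auto
  also have "\<dots> = [n - 1] @ ssup n k j @ ssup n l (j + 1)"
    using ssup_unfold[OF assms(2), of k] by (simp add: ssup_def)
  finally show ?thesis .
qed

lemma block_push:
  assumes "1 \<le> j" "j < a" "a < n"
  shows "ssup n k j @ [a] \<simeq> [a - 1] @ ssup n k j"
proof -
  have w: "seg (n - 1) j \<in> words n" "[n] \<in> words n" using assms by (auto intro!: seg_in_words)
  have "ssup n k j @ [a] = replicate k n @ (seg (n - 1) j @ [a]) @ []" by (simp add: ssup_def)
  also have "\<dots> \<simeq> replicate k n @ ([a - 1] @ seg (n - 1) j) @ []"
    using assms w by (intro move_context seg_push) auto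
  also have "\<dots> = [] @ (replicate k n @ [a - 1]) @ seg (n - 1) j" by simp
  also have "\<dots> \<simeq> [] @ ([a - 1] @ replicate k n) @ seg (n - 1) j"
    using assms w by (intro move_context power_word_commute) auto
  finally show ?thesis by (simp add: ssup_def)
qed

text \<open>
  A letter multiplied on the right is absorbed by the suffix, shortens the word, or leaves the
  suffix on its left as some letter below \<open>n\<close>.  The bounds on the indices let the induction put
  blocks with larger indices back on the right.
\<close>

lemma suffix_times_letter:
  assumes "ps \<in> suffix_data d n" "1 \<le> a" "a < n"
  shows "(\<exists>qs \<in> suffix_data d n. (\<forall>m. (\<forall>j \<in> snd ` set ps. j < m) \<longrightarrow> (\<forall>j \<in> snd ` set qs. j < m))
            \<and> suffix_word n ps @ [a] \<simeq> suffix_word n qs)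
       \<or> shortens (suffix_word n ps @ [a])
       \<or> (\<exists>qs \<in> suffix_data d n. \<exists>b. 1 \<le> b \<and> b < n \<and> snd ` set qs = snd ` set ps
            \<and> suffix_word n ps @ [a] \<simeq> [b] @ suffix_word n qs)"
    (is "?absorbed ps a \<or> shortens (suffix_word n ps @ [a]) \<or> ?pushed ps a")
  using assms
proof (induction "length ps" arbitrary: ps a rule: less_induct)
  case less
  have sw: "suffix_word n qs \<in> words n" if "qs \<in> suffix_data d n" for qs
    using suffix_in_words[OF _ that] n_ge2 by simp
  let ?Q = "\<lambda>ps a. ?absorbed ps a \<or> shortens (suffix_word n ps @ [a]) \<or> ?pushed ps a"
  have push: "?Q ps a"
    if ps: "ps = rs @ ts" and rs: "length rs < length ps"
      and ts': "ts' \<in> suffix_data d n" "snd ` set ts' = snd ` set ts"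
      and b: "suffix_word n ts @ [a] \<simeq> [b] @ suffix_word n ts'" "1 \<le> b" "b < n" for rs ts ts' b
  proof -
    have data: "rs \<in> suffix_data d n" "ts \<in> suffix_data d n"
      and lt: "\<forall>i \<in> snd ` set rs. \<forall>j \<in> snd ` set ts. i < j"
      using less.prems(1) ps by (auto simp: suffix_data_append)
    have m1: "suffix_word n ps @ [a] \<simeq> (suffix_word n rs @ [b]) @ suffix_word n ts'"
      using move_context[OF b(1), of "suffix_word n rs" "[]"] sw data ps by simp
    have bw: "[b] \<in> words n" using b by simp
    consider (absorbed) "?absorbed rs b" | (short) "shortens (suffix_word n rs @ [b])" | (pushed) "?pushed rs b"
      using less.hyps[OF rs data(1) b(2,3)] by blast
    then show ?thesis
    proof cases
      case absorbed
      then obtain qs where qs: "qs \<in> suffix_data d n"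
          "\<And>m. \<forall>j \<in> snd ` set rs. j < m \<Longrightarrow> \<forall>j \<in> snd ` set qs. j < m"
          "suffix_word n rs @ [b] \<simeq> suffix_word n qs" by blast
      have lt': "\<forall>i \<in> snd ` set qs. \<forall>j \<in> snd ` set ts'. i < j"
        using qs(2) lt ts'(2) by blast
      then have "qs @ ts' \<in> suffix_data d n"
        using qs(1) ts'(1) by (simp add: suffix_data_append)
      moreover have "suffix_word n ps @ [a] \<simeq> suffix_word n (qs @ ts')"
        using move_trans[OF m1] move_context[OF qs(3), of "[]" "suffix_word n ts'"] sw[OF ts'(1)] by simp
      moreover have "\<forall>m. (\<forall>j \<in> snd ` set ps. j < m) \<longrightarrow> (\<forall>j \<in> snd ` set (qs @ ts'). j < m)"
        unfolding ps set_append image_Un ts'(2) using qs(2) by blast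
      ultimately show ?thesis by blast
    next
      case short
      then have "shortens ((suffix_word n rs @ [b]) @ suffix_word n ts')"
        using shortens_context[of "suffix_word n rs @ [b]" "[]" "suffix_word n ts'"] sw[OF ts'(1)] by simp
      then have "shortens (suffix_word n ps @ [a])"
        using shortens_move[OF m1] sw less.prems by simp
      then show ?thesis by blast
    next
      case pushed
      then obtain qs c where qs: "qs \<in> suffix_data d n" "1 \<le> c" "c < n"
          "snd ` set qs = snd ` set rs" "suffix_word n rs @ [b] \<simeq> [c] @ suffix_word n qs" by blast
      have "qs @ ts' \<in> suffix_data d n"
        unfolding suffix_data_append qs(4) ts'(2) using qs(1) ts'(1) lt by simp
      moreover have "suffix_word n ps @ [a] \<simeq> [c] @ suffix_word n (qs @ ts')"
        using move_trans[OF m1] move_context[OF qs(5), of "[]" "suffix_word n ts'"] sw[OF ts'(1)] by simp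
      moreover have "snd ` set (qs @ ts') = snd ` set ps"
        using qs(4) ts'(2) ps by (simp add: image_Un)
      ultimately show ?thesis using qs(2,3) by blast
    qed
  qed
  show ?case
  proof (cases ps rule: rev_exhaust)
    case Nil
    then show ?thesis using less.prems move_refl
      by (intro disjI2 bexI[of _ "[]"] exI[of _ a]) simp_all
  next
    case (snoc rs kj)
    obtain k j where ps: "ps = rs @ [(k, j)]" using snoc by (cases kj) auto
    have data: "rs \<in> suffix_data d n" "1 \<le> k" "k \<le> d - 1" "1 \<le> j" "j \<le> n"
        "\<forall>i \<in> snd ` set rs. i < j"
      using less.prems(1) ps by (auto simp: suffix_data_append)
    have block: "[(k, j)] \<in> suffix_data d n" using data by simp
    consider "a + 1 < j" | "a + 1 = j" | "a = j" | "j < a" by linarith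
    then show ?thesis
    proof cases
      case 1
      then have "ssup n k j @ [a] \<simeq> [a] @ ssup n k j"
        using data less.prems
        by (intro comm_imp_move[OF comm_sym] letter_word_commute) (auto simp: ssup_def intro!: seg_in_words)
      then show ?thesis using push[OF ps _ block, of a] ps less.prems by simp
    next
      case 2
      show ?thesis
      proof (cases "\<forall>i \<in> snd ` set rs. i < a")
        case True
        have "suffix_word n ps @ [a] = suffix_word n (rs @ [(k, a)])"
          using ps 2 less.prems ssup_snoc[of a n k] by simp
        moreover have "rs @ [(k, a)] \<in> suffix_data d n"
          using True data less.prems by (auto simp: suffix_data_append)
        moreover have "\<forall>m. (\<forall>j \<in> snd ` set ps. j < m) \<longrightarrow> (\<forall>j \<in> snd ` set (rs @ [(k, a)]). j < m)"
          using ps 2 by auto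
        ultimately show ?thesis using move_refl by metis
      next
        case False
        \<comment> \<open>sortedness leaves only the last block of \<open>rs\<close> to have index \<open>a\<close>\<close>
        then obtain qs lj where rs: "rs = qs @ [lj]" by (cases rs rule: rev_exhaust) auto
        obtain l i where lj: "lj = (l, i)" by fastforce
        have qs: "qs \<in> suffix_data d n" "1 \<le> l" "l \<le> d - 1" "1 \<le> i" "\<forall>i' \<in> snd ` set qs. i' < i"
          using data(1) rs lj by (auto simp: suffix_data_append)
        have "i = a" using False rs lj qs data(6) 2 by fastforce
        have ps': "ps = qs @ [(l, a), (k, j)]" using ps rs lj \<open>i = a\<close> by simp
        have "suffix_word n [(l, a), (k, j)] @ [a] = ssup n l a @ ssup n k a"
          using 2 less.prems ssup_snoc[of a n k] by simp
        also have "\<dots> \<simeq> [n - 1] @ ssup n k a @ ssup n l (a + 1)"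
          using less.prems data qs by (intro block_swap) auto
        also have "\<dots> = [n - 1] @ suffix_word n [(k, a), (l, j)]" using 2 by simp
        finally show ?thesis
          using push[OF ps', of "[(k, a), (l, j)]" "n - 1"] ps' qs data 2 less.prems by simp
      qed
    next
      case 3
      let ?x = "suffix_word n rs @ ssup n k (Suc a)"
      have "suffix_word n ps @ [a] = ?x @ [a, a] @ []"
        using 3 ps less.prems ssup_snoc[of a n k] by simp
      moreover have "?x \<in> words n"
        using sw[OF data(1)] n_ge2 by (simp add: ssup_in_words)
      ultimately have "shortens (suffix_word n ps @ [a])"
        using shortens_context[OF shortens_square, of a ?x "[]"] less.prems by simp
      then show ?thesis by blast
    next
      case 4
      then have "ssup n k j @ [a] \<simeq> [a - 1] @ ssup n k j"
        using data less.prems by (intro block_push) auto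
      then show ?thesis using push[OF ps _ block, of "a - 1"] ps less.prems 4 data by simp
    qed
  qed
qed

lemma suffix_times_last_letter:
  assumes "ps \<in> suffix_data d n"
  shows "(\<exists>qs \<in> suffix_data d n. suffix_word n ps @ [n] = suffix_word n qs) \<or> shortens (suffix_word n ps @ [n])"
proof (cases ps rule: rev_exhaust)
  case Nil
  show ?thesis
  proof (cases "d = 1")
    case True
    then have "shortens [n]" unfolding shortens_def using eqv_sym[OF eqv_power]
      by (intro exI[of _ "[]"]) simp
    then show ?thesis using Nil by simp
  next
    case False
    have "[n] = suffix_word n [(1, n)]" using n_ge2 by (simp add: ssup_def)
    moreover have "[(1, n)] \<in> suffix_data d n" using False d_pos n_ge2 by auto
    ultimately show ?thesis using Nil by (metis append_Nil suffix_word_simps(1))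
  qed
next
  case (snoc rs kj)
  obtain k j where ps: "ps = rs @ [(k, j)]" using snoc by (cases kj) auto
  have data: "rs \<in> suffix_data d n" "1 \<le> k" "k \<le> d - 1" "1 \<le> j" "j \<le> n" "\<forall>i \<in> snd ` set rs. i < j"
    using assms ps by (auto simp: suffix_data_append)
  consider "j < n" | "j = n" "k + 1 \<le> d - 1" | "j = n" "k + 1 = d" using data by linarith
  then show ?thesis
  proof cases
    case 1
    have "suffix_word n ps @ [n] = suffix_word n (ps @ [(1, n)])" using n_ge2 by (simp add: ssup_def)
    moreover have "ps @ [(1, n)] \<in> suffix_data d n"
      using assms data ps 1 by (fastforce simp: suffix_data_append)
    ultimately show ?thesis by metis
  next
    case 2
    have "suffix_word n ps @ [n] = suffix_word n (rs @ [(k + 1, n)])"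
      using n_ge2 2 ps by (simp add: ssup_def replicate_append_same)
    moreover have "rs @ [(k + 1, n)] \<in> suffix_data d n"
      using data 2 by (fastforce simp: suffix_data_append)
    ultimately show ?thesis by metis
  next
    case 3
    have "suffix_word n ps @ [n] = suffix_word n rs @ replicate d n @ []"
      using n_ge2 3 ps by (auto simp: ssup_def replicate_append_same)
    moreover have "shortens (replicate d n)"
      unfolding shortens_def using eqv_sym[OF eqv_power] d_pos by (intro exI[of _ "[]"]) auto
    moreover have "suffix_word n rs \<in> words n" using suffix_in_words data n_ge2 by simp
    ultimately show ?thesis using shortens_context[of "replicate d n" "suffix_word n rs" "[]"] by simp
  qed
qed

lemma canonicalI:
  "p \<in> prefix_words n \<Longrightarrow> ps \<in> suffix_data d n \<Longrightarrow> p @ suffix_word n ps \<in> canonical_words d n"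
  unfolding canonical_words_def prefixes_eq by blast

lemma canonical_in_words: "w \<in> canonical_words d n \<Longrightarrow> w \<in> words n"
  unfolding canonical_words_def prefixes_eq
  using prefix_words_in_words[OF _ le_SucI[OF order_refl]] suffix_in_words[of n _ d] n_ge2 by auto

lemma canonical_times_letter:
  assumes "w \<in> canonical_words d n" "1 \<le> a" "a \<le> n"
  shows "(\<exists>v \<in> canonical_words d n. w @ [a] \<simeq> v) \<or> shortens (w @ [a])"
proof -
  obtain p ps where p: "p \<in> prefix_words n" and ps: "ps \<in> suffix_data d n" and w: "w = p @ suffix_word n ps"
    using assms(1) unfolding canonical_words_def prefixes_eq by blast
  have pw: "p \<in> words n" and sw: "\<And>qs. qs \<in> suffix_data d n \<Longrightarrow> suffix_word n qs \<in> words n"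
    using prefix_words_in_words[OF p] suffix_in_words n_ge2 by auto
  have short: ?thesis if "shortens (suffix_word n ps @ [a])"
    using shortens_context[OF that, of p "[]"] pw w by simp
  have absorbed: ?thesis if "qs \<in> suffix_data d n" "suffix_word n ps @ [a] \<simeq> suffix_word n qs" for qs
    using move_context[OF that(2), of p "[]"] canonicalI[OF p that(1)] pw w by auto
  show ?thesis
  proof (cases "a = n")
    case True
    then show ?thesis using suffix_times_last_letter[OF ps] short absorbed move_refl by metis
  next
    case False
    then have "a < n" using assms by simp
    have pushed: ?thesis if qs: "qs \<in> suffix_data d n" "1 \<le> b" "b < n"
      "suffix_word n ps @ [a] \<simeq> [b] @ suffix_word n qs" for qs b
    proof -
      have m: "w @ [a] \<simeq> (p @ [b]) @ suffix_word n qs"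
        using move_context[OF qs(4), of p "[]"] pw w by simp
      consider q where "q \<in> prefix_words n" "p @ [b] \<simeq> q" | "shortens (p @ [b])"
        using prefix_times_letter[OF p _ qs(2,3)] by auto
      then show ?thesis
      proof cases
        case 1
        have "w @ [a] \<simeq> q @ suffix_word n qs"
          using move_trans[OF m] move_context[OF 1(2), of "[]" "suffix_word n qs"] sw[OF qs(1)] by simp
        then show ?thesis using canonicalI[OF 1(1) qs(1)] by blast
      next
        case 2
        then have "shortens ((p @ [b]) @ suffix_word n qs)"
          using shortens_context[of "p @ [b]" "[]" "suffix_word n qs"] sw[OF qs(1)] by simp
        then show ?thesis
          using shortens_move[OF m] canonical_in_words[OF assms(1)] assms by simp
      qed
    qed
    show ?thesis
      using suffix_times_letter[OF ps assms(2) \<open>a < n\<close>] short absorbed pushed by blast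
  qed
qed

text \<open>
  This does the work that Matsumoto's theorem does for Coxeter groups: it yields that canonical words are reduced and that each reduced word reaches the canonical one by
  length-preserving moves.
\<close>

theorem word_to_canonical:
  assumes "u \<in> words n"
  shows "(\<exists>v \<in> canonical_words d n. u \<simeq> v) \<or> shortens u"
  using assms
proof (induction u rule: rev_induct)
  case Nil
  have nil: "[] \<in> prefix_words m" for m
  proof (induction m)
    case (Suc m)
    then show ?case using prefix_words_SucI[of "[]" m "Suc m"] by simp
  qed simp
  then show ?case using canonicalI[of "[]" "[]"] move_refl by fastforce
next
  case (snoc a u)
  then have aw: "1 \<le> a" "a \<le> n" "u \<in> words n" "[a] \<in> words n" by auto
  from snoc.IH[OF aw(3)] show ?case
  proof
    assume "shortens u"
    then show ?thesis using shortens_context[of u "[]" "[a]"] aw by simp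
  next
    assume "\<exists>v \<in> canonical_words d n. u \<simeq> v"
    then obtain v where v: "v \<in> canonical_words d n" "u \<simeq> v" by blast
    have m: "u @ [a] \<simeq> v @ [a]" using move_context[OF v(2), of "[]" "[a]"] aw by simp
    show ?thesis using canonical_times_letter[OF v(1) aw(1,2)]
      using move_trans[OF m] shortens_move[OF m snoc.prems] by blast
  qed
qed

end

section \<open>Distinct canonical words represent distinct elements\<close>

text \<open>
  The group acts on coloured positions: \<open>s\<^sub>i\<close> exchanges positions \<open>i\<close> and \<open>i + 1\<close>, and
  \<open>s\<^sub>n\<close> adds one to the colour at position \<open>n\<close>.  Letters act from left to right.  Colours are kept
  in the integers and compared modulo \<open>d\<close>, which makes every letter invertible without reference
  to \<open>d\<close>.
\<close>

definition swap_pos :: "nat \<Rightarrow> nat \<Rightarrow> nat \<Rightarrow> nat" where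
  "swap_pos n a x = (if a < n then (if x = a then a + 1 else if x = a + 1 then a else x) else x)"

fun end_pos :: "nat \<Rightarrow> (nat \<times> bool) list \<Rightarrow> nat \<Rightarrow> nat" where
  "end_pos n [] x = x"
| "end_pos n ((a, b) # w) x = end_pos n w (swap_pos n a x)"

fun colour_gain :: "nat \<Rightarrow> (nat \<times> bool) list \<Rightarrow> nat \<Rightarrow> int" where
  "colour_gain n [] x = 0"
| "colour_gain n ((a, b) # w) x = (if a = n \<and> x = n then (if b then 1 else - 1) else 0) + colour_gain n w (swap_pos n a x)"

lemma end_pos_append [simp]: "end_pos n (u @ v) x = end_pos n v (end_pos n u x)"
  by (induction u arbitrary: x) auto

lemma colour_gain_append [simp]: "colour_gain n (u @ v) x = colour_gain n u x + colour_gain n v (end_pos n u x)"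
  by (induction u arbitrary: x) auto

lemma swap_pos_involution [simp]: "swap_pos n a (swap_pos n a x) = x"
  by (auto simp: swap_pos_def)

lemma bij_end_pos: "bij (end_pos n w)"
proof (induction w)
  case Nil
  then show ?case by (simp add: bij_def inj_def surj_def)
next
  case (Cons l w)
  obtain a b where l: "l = (a, b)" by fastforce
  have "bij (swap_pos n a)" by (rule bij_betw_byWitness[of _ "swap_pos n a"]) auto
  then have "bij (end_pos n w \<circ> swap_pos n a)" using Cons.IH by (rule bij_comp)
  then show ?case by (simp add: l comp_def)
qed

lemma end_pos_inject [simp]: "end_pos n w x = end_pos n w y \<longleftrightarrow> x = y"
  using bij_end_pos[of n w] by (auto simp: bij_def inj_def)

lemma end_pos_surj: "\<exists>x. end_pos n w x = y"
  using bij_end_pos[of n w] by (metis bij_def surj_def)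

lemma replicate_last_letter:
  "end_pos n (positive (replicate k n)) x = x"
  "colour_gain n (positive (replicate k n)) x = (if x = n then int k else 0)"
  by (induction k) (auto simp: swap_pos_def)

lemma colour_gain_no_last: "n \<notin> set w \<Longrightarrow> colour_gain n (positive w) x = 0"
  by (induction w arbitrary: x) auto

lemma relation_action:
  assumes "(l, r) \<in> grel d n"
  shows "end_pos n (positive l) x = end_pos n (positive r) x \<and>
         int d dvd colour_gain n (positive l) x - colour_gain n (positive r) x"
proof -
  have "(l, r) = (replicate d n, []) \<or> (\<exists>i. (l, r) = ([i, i], []) \<and> 1 \<le> i \<and> i < n)
      \<or> (\<exists>i j. (l, r) = ([i, j], [j, i]) \<and> 1 \<le> j \<and> j + 1 < i \<and> i \<le> n)
      \<or> (\<exists>i. (l, r) = ([i + 1, i, i + 1], [i, i + 1, i]) \<and> 1 \<le> i \<and> i + 2 \<le> n)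
      \<or> 2 \<le> n \<and> (l, r) = ([n, n - 1, n, n - 1], [n - 1, n, n - 1, n])"
    using assms unfolding grel_def by (auto split: if_splits)
  then show ?thesis
  proof (elim disjE exE conjE)
    assume "(l, r) = (replicate d n, [])"
    then show ?thesis by (simp add: replicate_last_letter)
  qed (auto simp: swap_pos_def)
qed

lemma cong_action:
  assumes "pres_cong {1..n} (grel d n) u v"
  shows "end_pos n u x = end_pos n v x \<and> int d dvd colour_gain n u x - colour_gain n v x"
  using assms
proof (induction arbitrary: x rule: pres_cong.induct)
  case (sym u v)
  then show ?case using dvd_diff_commute by metis
next
  case (trans u v w)
  then have "int d dvd (colour_gain n u x - colour_gain n v x) + (colour_gain n v x - colour_gain n w x)"
    by (intro dvd_add) auto
  then show ?case using trans by simp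
next
  case (cancel y z a b)
  then show ?case by (auto simp: swap_pos_def)
next
  case (relation y z l r)
  then show ?case using relation_action[of l r d n "end_pos n y x"] by simp
qed simp

lemma end_pos_seg:
  assumes "1 \<le> j" "j \<le> Suc m" "m < n"
  shows "end_pos n (positive (seg m j)) x = (if x = Suc m then j else if j \<le> x \<and> x \<le> m then Suc x else x)"
  using assms
proof (induction m arbitrary: x)
  case 0
  then have "seg 0 j = []" by simp
  then show ?case using 0 by simp
next
  case (Suc m)
  show ?case
  proof (cases "j \<le> Suc m")
    case True
    then show ?thesis using Suc by (auto simp: seg_Suc swap_pos_def)
  next
    case False
    then show ?thesis using Suc by simp
  qed
qed

lemma end_pos_ssup:
  "\<lbrakk>1 \<le> j; j \<le> n\<rbrakk> \<Longrightarrow>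
    end_pos n (positive (ssup n k j)) x = (if x = n then j else if j \<le> x \<and> x < n then Suc x else x)"
  using end_pos_seg[of j "n - 1" n x] by (auto simp: ssup_def replicate_last_letter)

lemma colour_gain_ssup:
  "\<lbrakk>1 \<le> j; j \<le> n\<rbrakk> \<Longrightarrow> colour_gain n (positive (ssup n k j)) x = (if x = n then int k else 0)"
  using colour_gain_no_last[of n "seg (n - 1) j"] by (auto simp: ssup_def replicate_last_letter)

lemma suffix_fixes:
  assumes "ps \<in> suffix_data d n" "\<forall>j \<in> snd ` set ps. x < j"
  shows "end_pos n (positive (suffix_word n ps)) x = x \<and> colour_gain n (positive (suffix_word n ps)) x = 0"
  using assms
proof (induction ps)
  case (Cons kj ps)
  obtain k j where kj: "kj = (k, j)" by fastforce
  with Cons show ?case by (auto simp: end_pos_ssup colour_gain_ssup)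
qed simp

text \<open>
  A block \<open>(k, j)\<close> colours what stands at position \<open>n\<close> by \<open>k\<close> and carries it to position \<open>j\<close>, where it
  stays because the later blocks only move positions above \<open>j\<close>.  So the final colours display the
  list of blocks.
\<close>

lemma suffix_action:
  assumes "ps \<in> suffix_data d n" and "y = end_pos n (positive (suffix_word n ps)) x"
  shows "(\<forall>(k, j) \<in> set ps. y = j \<longrightarrow> colour_gain n (positive (suffix_word n ps)) x = int k)
    \<and> (y \<notin> snd ` set ps \<longrightarrow> colour_gain n (positive (suffix_word n ps)) x = 0)"
  using assms
proof (induction ps arbitrary: x y)
  case (Cons kj ps)
  obtain k j where kj: "kj = (k, j)" by fastforce
  with Cons.prems have data: "1 \<le> j" "j \<le> n" "ps \<in> suffix_data d n" "\<forall>j' \<in> snd ` set ps. j < j'"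
    by auto
  let ?S = "positive (suffix_word n ps)"
  have fix_j: "end_pos n ?S j = j" "colour_gain n ?S j = 0"
    using suffix_fixes[OF data(3,4)] by auto
  have notin: "j \<notin> snd ` set ps" using data(4) by blast
  show ?case
  proof (cases "x = n")
    case True
    then have "y = j" "colour_gain n (positive (suffix_word n (kj # ps))) x = int k"
      using Cons.prems(2) fix_j data by (simp_all add: kj end_pos_ssup colour_gain_ssup)
    then show ?thesis using notin kj by force
  next
    case False
    define x' where "x' = end_pos n (positive (ssup n k j)) x"
    have y: "y = end_pos n ?S x'" using Cons.prems(2) by (simp add: kj x'_def)
    have "x' \<noteq> j" using False data by (auto simp: x'_def end_pos_ssup)
    then have "y \<noteq> j" using y fix_j(1) end_pos_inject[of n ?S x' j] by simp
    moreover have "colour_gain n (positive (suffix_word n (kj # ps))) x = colour_gain n ?S x'"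
      using False data by (simp add: kj x'_def colour_gain_ssup)
    ultimately show ?thesis using Cons.IH[OF data(3) y] kj by auto
  qed
qed simp

lemma end_pos_above: "\<lbrakk>\<forall>a \<in> set w. Suc a < x; x \<le> n\<rbrakk> \<Longrightarrow> end_pos n (positive w) x = x"
  by (induction w) (auto simp: swap_pos_def)

text \<open>
  The last segment alone moves the top position, to its lower end; so that end can be read off
  and the segment cancelled.
\<close>

lemma prefix_unique:
  assumes "p \<in> prefix_words m" "q \<in> prefix_words m" "m \<le> n"
    and "\<And>x. end_pos n (positive p) x = end_pos n (positive q) x"
  shows "p = q"
  using assms
proof (induction m arbitrary: p q)
  case (Suc m)
  obtain p' i where p: "p' \<in> prefix_words m" "1 \<le> i" "i \<le> Suc m" "p = p' @ seg m i"
    using Suc.prems(1) by auto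
  obtain q' j where q: "q' \<in> prefix_words m" "1 \<le> j" "j \<le> Suc m" "q = q' @ seg m j"
    using Suc.prems(2) by auto
  have fixes_top: "end_pos n (positive r) (Suc m) = Suc m" if "r \<in> prefix_words m" for r
    using set_prefix_words[OF that] Suc.prems(3) by (intro end_pos_above) auto
  have "i = j"
    using Suc.prems(4)[of "Suc m"] p q Suc.prems(3) by (simp add: fixes_top end_pos_seg)
  moreover have "p' = q'"
  proof (rule Suc.IH[OF p(1) q(1)])
    fix x
    have "end_pos n (positive (seg m i)) (end_pos n (positive p') x) = end_pos n (positive (seg m i)) (end_pos n (positive q') x)"
      using Suc.prems(4)[of x] p q \<open>i = j\<close> by simp
    then show "end_pos n (positive p') x = end_pos n (positive q') x"
      by simp
  qed (use Suc.prems in simp)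
  ultimately show ?case using p q by simp
qed simp

lemma suffix_data_eqI:
  assumes "ps \<in> suffix_data d n" "qs \<in> suffix_data d n" "set ps = set qs"
  shows "ps = qs"
proof -
  have s: "sorted_wrt (<) (map snd ps)" "sorted_wrt (<) (map snd qs)"
    using assms by (auto simp: suffix_data_def)
  then have "map snd ps = map snd qs"
    using assms(3) by (intro strict_sorted_equal) auto
  moreover have "inj_on snd (set ps)"
    using s(1) by (simp add: strict_sorted_iff distinct_map)
  ultimately show ?thesis
    using assms(3) by (metis inj_on_map_eq_map Un_absorb)
qed

context cyclotomic
begin

text \<open>
  The exponents lie in \<open>{1..d - 1}\<close>, so they are nonzero and distinct modulo \<open>d\<close>: the final colour at
  a position tells whether it is the index of a block, and of which exponent.
\<close>

lemma suffix_determined: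
  assumes "p \<in> prefix_words n" "q \<in> prefix_words n" "ps \<in> suffix_data d n" "qs \<in> suffix_data d n"
    and "p @ suffix_word n ps \<approx> q @ suffix_word n qs"
  shows "set ps \<subseteq> set qs"
proof
  fix kj assume kj: "kj \<in> set ps"
  obtain k j where [simp]: "kj = (k, j)" by fastforce
  have k: "1 \<le> k" "k \<le> d - 1" using kj assms(3) by (auto simp: suffix_data_def)
  have no_last: "n \<notin> set r" if "r \<in> prefix_words n" for r
    using set_prefix_words[OF that] by auto
  obtain x where x: "end_pos n (positive (p @ suffix_word n ps)) x = j"
    using end_pos_surj by blast
  have act: "end_pos n (positive (q @ suffix_word n qs)) x = j"
    "int d dvd colour_gain n (positive (p @ suffix_word n ps)) x - colour_gain n (positive (q @ suffix_word n qs)) x"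
    using cong_action[of n d] assms(5) x unfolding eqv_iff_cong by metis+
  have colp: "colour_gain n (positive (p @ suffix_word n ps)) x = int k"
    using suffix_action[OF assms(3) HOL.refl, of "end_pos n (positive p) x"] kj x no_last[OF assms(1)]
    by (auto simp: colour_gain_no_last)
  have colq: "(\<forall>(k', j') \<in> set qs. j = j' \<longrightarrow> colour_gain n (positive (q @ suffix_word n qs)) x = int k')
      \<and> (j \<notin> snd ` set qs \<longrightarrow> colour_gain n (positive (q @ suffix_word n qs)) x = 0)"
    using suffix_action[OF assms(4) HOL.refl, of "end_pos n (positive q) x"] act(1) no_last[OF assms(2)]
    by (simp add: colour_gain_no_last)
  have "j \<in> snd ` set qs"
  proof (rule ccontr)
    assume "j \<notin> snd ` set qs"
    then have "int d dvd int k" using colq act(2) colp by simp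
    then show False using k by (auto dest: dvd_imp_le)
  qed
  then obtain k' where k': "(k', j) \<in> set qs" by auto
  then have "int d dvd int k - int k'" using colq act(2) colp by auto
  moreover have "1 \<le> k'" "k' \<le> d - 1" using k' assms(4) by (auto simp: suffix_data_def)
  ultimately have "k = k'"
    using k zdvd_imp_le[of "int d" "int k - int k'"] zdvd_imp_le[of "int d" "int k' - int k"]
      dvd_diff_commute[of "int d" "int k" "int k'"] by linarith
  then show "kj \<in> set qs" using k' by simp
qed

theorem canonical_unique:
  assumes "v \<in> canonical_words d n" "w \<in> canonical_words d n" "v \<approx> w"
  shows "v = w"
proof -
  obtain p ps where p: "p \<in> prefix_words n" and ps: "ps \<in> suffix_data d n" and v: "v = p @ suffix_word n ps"
    using assms(1) unfolding canonical_words_def prefixes_eq by blast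
  obtain q qs where q: "q \<in> prefix_words n" and qs: "qs \<in> suffix_data d n" and w: "w = q @ suffix_word n qs"
    using assms(2) unfolding canonical_words_def prefixes_eq by blast
  have eq: "ps = qs"
    using suffix_determined[OF p q ps qs] suffix_determined[OF q p qs ps] assms(3) eqv_sym v w
    by (intro suffix_data_eqI[OF ps qs]) blast
  have "p = q"
  proof (rule prefix_unique[OF p q order_refl])
    fix x
    have "end_pos n (positive v) x = end_pos n (positive w) x"
      using assms(3) cong_action unfolding eqv_iff_cong by blast
    then show "end_pos n (positive p) x = end_pos n (positive q) x"
      using v w eq by simp
  qed
  with eq v w show ?thesis by simp
qed

section \<open>A braid criterion for full commutativity\<close>

lemma reduced_imp_moves:
  assumes "w \<in> canonical_words d n" "u \<in> reduced_words d n (elt d n w)"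
  shows "u \<simeq> w"
proof -
  have u: "u \<in> words n" "elt d n u = elt d n w"
      "\<And>v. v \<in> words n \<Longrightarrow> elt d n v = elt d n w \<Longrightarrow> length u \<le> length v"
    using assms(2) by (auto simp: reduced_words_def)
  have "\<not> shortens u" using u by (force simp: shortens_def eqv_def)
  then obtain v where v: "v \<in> canonical_words d n" "u \<simeq> v" using word_to_canonical[OF u(1)] by blast
  then have "v \<approx> w" using move_eqv[OF v(2) u(1)] u(2) canonical_in_words[OF assms(1)] by (auto simp: eqv_def)
  with v canonical_unique assms(1) show ?thesis by blast
qed

lemma canonical_reduced:
  assumes "w \<in> canonical_words d n"
  shows "w \<in> reduced_words d n (elt d n w)"
proof -
  have ww: "w \<in> words n" using canonical_in_words[OF assms] .
  define P where "P u \<longleftrightarrow> u \<in> words n \<and> elt d n u = elt d n w" for u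
  have "P w" using ww by (simp add: P_def)
  then obtain u where u: "P u" "\<And>v. P v \<Longrightarrow> length u \<le> length v"
    by (metis ex_has_least_nat)
  then have r: "u \<in> reduced_words d n (elt d n w)" by (auto simp: reduced_words_def P_def)
  have "length u = length w"
    using move_eqv[OF reduced_imp_moves[OF assms r]] u by (simp add: P_def)
  then show ?thesis using u ww by (auto simp: reduced_words_def P_def)
qed

definition has_braid :: "nat list \<Rightarrow> bool" where
  "has_braid w \<longleftrightarrow> (\<exists>x y l r. w \<sim> x @ l @ y \<and> x \<in> words n \<and> y \<in> words n \<and> braid l r)"

text \<open>
  Neighbouring letters never pass each other under commutations, so the subword of letters \<open>i\<close> and
  \<open>i + 1\<close> is an invariant of the commutation class.
\<close>

lemma comm_filter:
  assumes "u \<sim> v"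
  shows "filter (\<lambda>a. a = i \<or> a = Suc i) u = filter (\<lambda>a. a = i \<or> a = Suc i) v"
  using assms unfolding comm_equiv_def
proof (induction rule: rtrancl_induct)
  case (step v w)
  then obtain x y a b where "v = x @ [a, b] @ y" "w = x @ [b, a] @ y" "b + 1 < a \<or> a + 1 < b"
    unfolding comm_step_def by blast
  then have "filter (\<lambda>a. a = i \<or> a = Suc i) v = filter (\<lambda>a. a = i \<or> a = Suc i) w" by auto
  with step.IH show ?case by simp
qed simp

lemma filter_const: "filter P (replicate k a) = (if P a then replicate k a else [])"
  by (induction k) auto

lemma braid_filter:
  assumes "braid l r"
  shows "\<exists>i. filter (\<lambda>a. a = i \<or> a = Suc i) l \<noteq> filter (\<lambda>a. a = i \<or> a = Suc i) r"
  using assms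
proof cases
  case (three i j)
  then show ?thesis by (intro exI[of _ "min i j"]) auto
next
  case (four a b)
  obtain a' where "a = Suc a'" using four by (cases a) auto
  then have "hd l = n" "hd r = n - 1" "l \<noteq> []" "r \<noteq> []" using four by auto
  moreover have "filter (\<lambda>a. a = n - 1 \<or> a = Suc (n - 1)) l = l" "filter (\<lambda>a. a = n - 1 \<or> a = Suc (n - 1)) r = r"
    using four n_ge2 by (auto simp: filter_const)
  ultimately show ?thesis using n_ge2 by (intro exI[of _ "n - 1"]) auto
next
  case (four_rev a b)
  obtain a' where "a = Suc a'" using four_rev by (cases a) auto
  then have "hd r = n" "hd l = n - 1" "l \<noteq> []" "r \<noteq> []" using four_rev by auto
  moreover have "filter (\<lambda>a. a = n - 1 \<or> a = Suc (n - 1)) l = l" "filter (\<lambda>a. a = n - 1 \<or> a = Suc (n - 1)) r = r"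
    using four_rev n_ge2 by (auto simp: filter_const)
  ultimately show ?thesis using n_ge2 by (intro exI[of _ "n - 1"]) auto
qed

text \<open>
  Applying a braid to a word in the class of \<open>w\<close> leaves the class, because it changes one of the
  invariants of \<open>comm_filter\<close>.  Conversely, a chain of moves from a reduced word to \<open>w\<close>,
  traced back from \<open>w\<close>, can only leave the class through a braid.
\<close>

theorem fully_commutative_iff:
  assumes "w \<in> canonical_words d n"
  shows "fully_commutative d n (elt d n w) \<longleftrightarrow> \<not> has_braid w"
proof
  assume fc: "fully_commutative d n (elt d n w)"
  show "\<not> has_braid w"
  proof
    assume "has_braid w"
    then obtain x y l r where b: "w \<sim> x @ l @ y" "x \<in> words n" "y \<in> words n" "braid l r"
      unfolding has_braid_def by blast
    have ww: "w \<in> words n" using canonical_in_words[OF assms] .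
    have "(x @ l @ y, x @ r @ y) \<in> braid_step" unfolding braid_step_def using b by blast
    then have "x @ l @ y \<simeq> x @ r @ y" unfolding move_equiv_def by blast
    with comm_imp_move[OF b(1)] have "w \<simeq> x @ r @ y" by (rule move_trans)
    then have "w \<approx> x @ r @ y" "length w = length (x @ r @ y)" using move_eqv ww by blast+
    then have "x @ r @ y \<in> reduced_words d n (elt d n w)"
      using canonical_reduced[OF assms] by (auto simp: reduced_words_def eqv_def)
    then have "w \<sim> x @ r @ y"
      using fc canonical_reduced[OF assms] unfolding fully_commutative_def comm_equiv_def by blast
    then have "x @ l @ y \<sim> x @ r @ y" using comm_trans[OF comm_sym[OF b(1)]] by blast
    then show False using comm_filter[of "x @ l @ y" "x @ r @ y"] braid_filter[OF b(4)] by auto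
  qed
next
  assume nb: "\<not> has_braid w"
  have comm: "u \<sim> w" if "u \<in> reduced_words d n (elt d n w)" for u
    using reduced_imp_moves[OF assms that] unfolding move_equiv_def
  proof (induction rule: converse_rtrancl_induct)
    case (step u v)
    from step.hyps(1) show ?case
    proof
      assume "(u, v) \<in> comm_step n"
      then have "u \<sim> v" by (auto simp: comm_equiv_def)
      then show ?thesis using step.IH by (rule comm_trans)
    next
      assume "(u, v) \<in> braid_step"
      then obtain x y l r where "v = x @ r @ y" "x \<in> words n" "y \<in> words n" "braid l r"
        unfolding braid_step_def by blast
      then have "has_braid w" unfolding has_braid_def using braid_sym comm_sym[OF step.IH] by blast
      with nb show ?thesis by blast
    qed
  qed simp
  show "fully_commutative d n (elt d n w)"
    unfolding fully_commutative_def using comm comm_trans comm_sym unfolding comm_equiv_def by blast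
qed

end

section \<open>Counting increasing prefixes\<close>

text \<open>
  Prefix words whose nonempty segments have strictly increasing lower ends, all at most \<open>k\<close>.
  For \<open>k = m\<close> these are the normal forms of the fully commutative elements of the symmetric group
  on \<open>m\<close> letters.
\<close>

fun incr_prefixes :: "nat \<Rightarrow> nat \<Rightarrow> nat list set" where
  "incr_prefixes 0 k = {[]}"
| "incr_prefixes (Suc m) k = incr_prefixes m k \<union> (\<Union>i \<in> {1..min m k}. (\<lambda>p. p @ seg m i) ` incr_prefixes m (i - 1))"

text \<open>
  The prefixes that can be followed by a single block of index \<open>k\<close>: lower ends from \<open>k\<close> on are
  allowed only in a final staircase of one-letter segments \<open>s\<^sub>l s\<^sub>l\<^sub>+\<^sub>1 \<dots> s\<^sub>m\<^sub>-\<^sub>1\<close>, because in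
  \<open>s\<^sub>l \<dots> s\<^sub>n\<^sub>-\<^sub>1 s\<^sub>n\<^sup>t s\<^sub>n\<^sub>-\<^sub>1 \<dots> s\<^sub>l\<close> two letters \<open>s\<^sub>p\<close> with \<open>p < n - 1\<close> enclose two letters \<open>s\<^sub>p\<^sub>+\<^sub>1\<close>.
\<close>

definition stair_prefixes :: "nat \<Rightarrow> nat \<Rightarrow> nat list set" where
  "stair_prefixes m k = (\<Union>l \<in> {k..m}. (\<lambda>p. p @ [l..<m]) ` incr_prefixes l (k - 1))"

lemma incr_mono: "k \<le> k' \<Longrightarrow> incr_prefixes m k \<subseteq> incr_prefixes m k'"
proof (induction m)
  case (Suc m)
  have "{1..min m k} \<subseteq> {1..min m k'}" using Suc.prems by auto
  then show ?case using Suc by fastforce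
qed simp

lemma incr_cap: "m \<le> Suc k \<Longrightarrow> incr_prefixes m (Suc k) = incr_prefixes m k"
proof (induction m)
  case (Suc m)
  then have "min m (Suc k) = min m k" by simp
  then show ?case using Suc by simp
qed simp

lemma incr_le_top: "incr_prefixes m k \<subseteq> incr_prefixes m m"
proof (cases "k \<le> m")
  case False
  have "incr_prefixes m (m + i) = incr_prefixes m m" for i
    by (induction i) (auto simp: incr_cap)
  then have "incr_prefixes m k = incr_prefixes m m" using False by (metis le_add_diff_inverse nat_le_linear)
  then show ?thesis by simp
qed (rule incr_mono)

lemma incr_subset_prefix_words: "incr_prefixes m k \<subseteq> prefix_words m"
proof (induction m arbitrary: k)
  case (Suc m)
  have "p \<in> prefix_words (Suc m)" if "p \<in> prefix_words m" for p
    using prefix_words_SucI[OF that, of "Suc m"] by simp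
  then show ?case using Suc prefix_words_SucI by fastforce
qed simp

lemma incr_set: "p \<in> incr_prefixes m k \<Longrightarrow> set p \<subseteq> {1..<m}"
  using incr_subset_prefix_words set_prefix_words by blast

lemma incr_last: "p \<in> incr_prefixes m k \<Longrightarrow> p \<noteq> [] \<Longrightarrow> last p \<le> k"
  by (induction m) (auto simp: seg_snoc)

lemma finite_incr: "finite (incr_prefixes m k)"
  by (induction m arbitrary: k) auto

lemma finite_stair: "finite (stair_prefixes m k)"
  by (simp add: stair_prefixes_def finite_incr)

lemma card_incr_Suc: "card (incr_prefixes (Suc m) k) = card (incr_prefixes m k) + (\<Sum>i = 1..min m k. card (incr_prefixes m (i - 1)))"
proof -
  let ?B = "\<lambda>i. (\<lambda>p. p @ seg m i) ` incr_prefixes m (i - 1)"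
  have last_B: "w \<noteq> [] \<and> m \<in> set w \<and> last w = i" if "w \<in> ?B i" "i \<in> {1..min m k}" for w i
    using that by (auto simp: seg_snoc)
  have disj: "?B i \<inter> ?B j = {}" if "i \<in> {1..min m k}" "j \<in> {1..min m k}" "i \<noteq> j" for i j
  proof (rule equals0I)
    fix w assume w: "w \<in> ?B i \<inter> ?B j"
    show False using last_B[OF IntD1[OF w] that(1)] last_B[OF IntD2[OF w] that(2)] that(3) by simp
  qed
  have "card (\<Union>i \<in> {1..min m k}. ?B i) = (\<Sum>i = 1..min m k. card (?B i))"
    using disj by (intro card_UN_disjoint ballI impI) (simp_all add: finite_incr)
  also have "\<dots> = (\<Sum>i = 1..min m k. card (incr_prefixes m (i - 1)))"
    by (intro sum.cong card_image) (auto simp: inj_on_def)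
  moreover have "incr_prefixes m k \<inter> (\<Union>i \<in> {1..min m k}. ?B i) = {}"
  proof (rule equals0I)
    fix w assume w: "w \<in> incr_prefixes m k \<inter> (\<Union>i \<in> {1..min m k}. ?B i)"
    then obtain i where "i \<in> {1..min m k}" "w \<in> ?B i" by blast
    with last_B have "m \<in> set w" by blast
    then show False using incr_set[OF IntD1[OF w]] by auto
  qed
  ultimately show ?thesis by (simp add: card_Un_disjoint finite_incr)
qed

text \<open>
  This is the recurrence of the Catalan triangle.  The sum in \<open>card_incr_Suc\<close> for \<open>k + 1\<close> exceeds
  the one for \<open>k\<close> by the single term \<open>card (incr_prefixes m k)\<close>.
\<close>

lemma card_incr_rec:
  "Suc k \<le> m \<Longrightarrow> card (incr_prefixes (Suc m) (Suc k)) = card (incr_prefixes m (Suc k)) + card (incr_prefixes (Suc m) k)"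
  unfolding card_incr_Suc by (simp add: min_def)

lemma catalan_triangle_rec:
  assumes "Suc k \<le> m"
  shows "catalan_triangle (Suc m) (Suc k) = catalan_triangle m (Suc k) + catalan_triangle (Suc m) k"
proof -
  define F where "F = (fact (m + k + 1) :: real)"
  define A where "A = (fact k :: real)"
  define B where "B = (fact (m + 1) :: real)"
  have nz: "A \<noteq> 0" "B \<noteq> 0" by (auto simp: A_def B_def)
  have 1: "catalan_triangle (Suc m) (Suc k) = (real m + real k + 2) * F * (real m - real k + 1) / ((real k + 1) * A * ((real m + 2) * B))"
    by (simp add: catalan_triangle_def F_def A_def B_def add_ac)
  have 2: "catalan_triangle m (Suc k) = F * (real m - real k) / ((real k + 1) * A * B)"
    by (simp add: catalan_triangle_def F_def A_def B_def add_ac)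
  have 3: "catalan_triangle (Suc m) k = F * (real m - real k + 2) / (A * ((real m + 2) * B))"
    by (simp add: catalan_triangle_def F_def A_def B_def add_ac)
  show ?thesis unfolding 1 2 3 using nz by (simp add: divide_simps) algebra
qed

lemma catalan_triangle_top: "catalan_triangle (Suc m) (Suc m) = catalan_triangle (Suc m) m"
  by (simp add: catalan_triangle_def divide_simps)

theorem card_incr: "k \<le> m \<Longrightarrow> real (card (incr_prefixes m k)) = catalan_triangle m k"
proof (induction m arbitrary: k)
  case 0
  then show ?case by (simp add: catalan_triangle_def)
next
  case (Suc m)
  note IH = Suc.IH
  from Suc.prems show ?case
  proof (induction k)
    case 0
    have "card (incr_prefixes (Suc m) 0) = 1" by (induction m) auto
    then show ?case by (simp add: catalan_triangle_def)
  next
    case (Suc k)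
    show ?case
    proof (cases "k = m")
      case True
      have "incr_prefixes (Suc m) (Suc m) = incr_prefixes (Suc m) m" by (rule incr_cap) simp
      then show ?thesis using Suc True catalan_triangle_top[of m] by simp
    next
      case False
      then show ?thesis
        using Suc IH[of "Suc k"] card_incr_rec[of k m] catalan_triangle_rec[of k m] by simp
    qed
  qed
qed

lemma stair_top: "1 \<le> k \<Longrightarrow> stair_prefixes k k = incr_prefixes k k"
  using incr_cap[of k "k - 1"] by (simp add: stair_prefixes_def)

lemma stair_Suc:
  "k \<le> m \<Longrightarrow> stair_prefixes (Suc m) k = incr_prefixes (Suc m) (k - 1) \<union> (\<lambda>p. p @ [m]) ` stair_prefixes m k"
  by (simp add: stair_prefixes_def atLeastAtMostSuc_conv image_UN image_image)

text \<open>
  Splitting by whether the staircase is empty gives the recurrence that also governs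
  \<^const>\<open>incr_prefixes\<close>.
\<close>

lemma card_stair:
  assumes "1 \<le> k" "k \<le> m"
  shows "card (stair_prefixes m k) = card (incr_prefixes m k)"
  using assms(2)
proof (induction m rule: dec_induct)
  case base
  then show ?case using stair_top assms(1) by simp
next
  case (step m)
  have "incr_prefixes (Suc m) (k - 1) \<inter> (\<lambda>p. p @ [m]) ` stair_prefixes m k = {}"
  proof (rule equals0I)
    fix w assume w: "w \<in> incr_prefixes (Suc m) (k - 1) \<inter> (\<lambda>p. p @ [m]) ` stair_prefixes m k"
    then obtain p where "w = p @ [m]" by blast
    then show False using incr_last[OF IntD1[OF w]] assms(1) step(1) by simp
  qed
  then have "card (stair_prefixes (Suc m) k) = card (incr_prefixes (Suc m) (k - 1)) + card (stair_prefixes m k)"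
    using stair_Suc[of k m] step(1)
    by (simp add: card_Un_disjoint finite_incr finite_stair card_image inj_on_def)
  then show ?case using step card_incr_rec[of "k - 1" m] assms(1) by simp
qed

section \<open>Prefixes forcing a braid\<close>

lemma incr_decomp:
  assumes "p \<in> incr_prefixes m K" "p \<notin> incr_prefixes m k"
  shows "\<exists>x q i. p = x @ seg q i \<and> k < i \<and> i \<le> q \<and> q < m \<and> x \<in> incr_prefixes q (i - 1)"
  using assms
proof (induction m)
  case (Suc m)
  show ?case
  proof (cases "p \<in> incr_prefixes m K")
    case True
    moreover have "p \<notin> incr_prefixes m k" using Suc.prems(2) by simp
    ultimately show ?thesis using Suc.IH less_SucI by blast
  next
    case False
    then obtain x i where xi: "p = x @ seg m i" "x \<in> incr_prefixes m (i - 1)" "1 \<le> i" "i \<le> m"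
      using Suc.prems(1) by auto
    moreover have "k < i"
    proof (rule ccontr)
      assume "\<not> k < i"
      then have "p \<in> incr_prefixes (Suc m) k" using xi by auto
      with Suc.prems(2) show False by blast
    qed
    ultimately show ?thesis by blast
  qed
qed simp

lemma not_incr_decomp:
  assumes "p \<in> prefix_words m" "p \<notin> incr_prefixes m m"
  shows "\<exists>x q i s j r. p = x @ seg q i @ seg s j @ r \<and> 1 \<le> j \<and> j \<le> i \<and> i \<le> q \<and> q < s \<and> s < m"
  using assms
proof (induction m arbitrary: p)
  case (Suc m)
  obtain p' j where p: "p' \<in> prefix_words m" "1 \<le> j" "j \<le> Suc m" "p = p' @ seg m j"
    using Suc.prems(1) by auto
  show ?case
  proof (cases "p' \<in> incr_prefixes m m")
    case False
    then obtain x q i s j' r where "p' = x @ seg q i @ seg s j' @ r" "1 \<le> j'" "j' \<le> i" "i \<le> q" "q < s" "s < m"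
      using Suc.IH[OF p(1)] by blast
    then show ?thesis using p(4)
      by (intro exI[of _ x] exI[of _ q] exI[of _ i] exI[of _ s] exI[of _ j'] exI[of _ "r @ seg m j"]) auto
  next
    case True
    have "j \<le> m"
    proof (rule ccontr)
      assume "\<not> j \<le> m"
      then have "p = p'" using p by simp
      then show False using True Suc.prems(2) incr_mono[of m "Suc m" m] by auto
    qed
    have "p' \<notin> incr_prefixes m (j - 1)" using Suc.prems(2) p \<open>j \<le> m\<close> by auto
    then obtain x q i where "p' = x @ seg q i" "j - 1 < i" "i \<le> q" "q < m"
      using incr_decomp[OF True] by blast
    then show ?thesis using p \<open>j \<le> m\<close>
      by (intro exI[of _ x] exI[of _ q] exI[of _ i] exI[of _ m] exI[of _ j] exI[of _ "[]"]) auto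
  qed
qed simp

lemma not_stair_decomp:
  assumes "1 \<le> k" "k \<le> m" "p \<in> incr_prefixes m m" "p \<notin> stair_prefixes m k"
  shows "\<exists>x q i l. p = x @ seg q i @ [l..<m] \<and> k \<le> i \<and> i \<le> q \<and> q < m \<and> Suc i < l \<and> l \<le> m"
  using assms(2-)
proof (induction m arbitrary: p rule: dec_induct)
  case base
  then show ?case using stair_top assms(1) by simp
next
  case (step m)
  have "p \<notin> incr_prefixes (Suc m) (k - 1)" using step stair_Suc by auto
  then obtain x q i where x: "p = x @ seg q i" "k - 1 < i" "i \<le> q" "q < Suc m" "x \<in> incr_prefixes q (i - 1)"
    using incr_decomp[OF step.prems(1)] by blast
  show ?case
  proof (cases "i < m")
    case True
    then show ?thesis using x
      by (intro exI[of _ x] exI[of _ q] exI[of _ i] exI[of _ "Suc m"]) auto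
  next
    case False
    then have eq: "i = m" "q = m" using x by auto
    then have "p = x @ [m]" using x(1) by simp
    then have "x \<notin> stair_prefixes m k" using step stair_Suc by auto
    moreover have "x \<in> incr_prefixes m m" using x(5) eq incr_le_top by blast
    ultimately obtain x' q' i' l where "x = x' @ seg q' i' @ [l..<m]" "k \<le> i'" "i' \<le> q'" "q' < m" "Suc i' < l" "l \<le> m"
      using step.IH by blast
    then show ?thesis using \<open>p = x @ [m]\<close>
      by (intro exI[of _ x'] exI[of _ q'] exI[of _ i'] exI[of _ l]) auto
  qed
qed

context cyclotomic
begin

lemma has_braidI: "\<lbrakk>w \<sim> x @ l @ y; x \<in> words n; y \<in> words n; braid l r\<rbrakk> \<Longrightarrow> has_braid w"
  unfolding has_braid_def by blast

text \<open>
  The lower end \<open>i\<close> of one segment commutes to the right until it meets \<open>s\<^sub>i\<^sub>+\<^sub>1 s\<^sub>i\<close> inside a later segment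
  that reaches down to \<open>i\<close>.
\<close>

lemma crossing_has_braid:
  assumes "x \<in> words n" "y \<in> words n" "z \<in> words n" "1 \<le> j" "j \<le> i" "i \<le> q" "q < n" "i < m" "m < n"
    and "\<forall>a \<in> set z. Suc i < a"
  shows "has_braid (x @ seg q i @ z @ seg m j @ y)"
proof -
  let ?l = "x @ seg q (Suc i)" and ?m = "seg m (i + 2)" and ?r = "seg (i - 1) j @ y"
  have "seg m j = seg m (i + 2) @ seg (i + 1) j" using seg_split[of j "i + 2" m] assms by simp
  also have "seg (i + 1) j = [i + 1, i] @ seg (i - 1) j"
    using seg_Suc[of j i] seg_Suc[of j "i - 1"] assms by simp
  finally have m: "seg m j = ?m @ [i + 1, i] @ seg (i - 1) j" .
  have w: "?l \<in> words n" "?m \<in> words n" "?r \<in> words n"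
    using assms by (auto intro!: seg_in_words)
  have "x @ seg q i @ z @ seg m j @ y = ?l @ ([i] @ (z @ ?m)) @ ([i + 1, i] @ ?r)"
    using m seg_snoc[of i q] assms by simp
  also have "\<dots> \<sim> ?l @ ((z @ ?m) @ [i]) @ ([i + 1, i] @ ?r)"
    using assms w by (intro comm_context letter_word_commute) auto
  also have "\<dots> = (?l @ z @ ?m) @ [i, i + 1, i] @ ?r" by simp
  finally have "x @ seg q i @ z @ seg m j @ y \<sim> (?l @ z @ ?m) @ [i, i + 1, i] @ ?r" .
  moreover have "braid [i, i + 1, i] [i + 1, i, i + 1]" using assms by (intro three) auto
  ultimately show ?thesis
    using has_braidI[of _ "?l @ z @ ?m" "[i, i + 1, i]" ?r] w assms(3) by simp
qed

lemma upt_in_words: "1 \<le> l \<Longrightarrow> [l..<n] \<in> words n"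
  by (auto simp: words_def in_lists_conv_set)

lemma not_incr_has_braid:
  assumes "p \<in> prefix_words n" "p \<notin> incr_prefixes n n" "y \<in> words n"
  shows "has_braid (p @ y)"
proof -
  obtain x q i s j r where p: "p = x @ seg q i @ seg s j @ r" "1 \<le> j" "j \<le> i" "i \<le> q" "q < s" "s < n"
    using not_incr_decomp[OF assms(1,2)] by blast
  have "p \<in> words n" using prefix_words_in_words[OF assms(1)] by simp
  then have "x \<in> words n" "r \<in> words n" using p(1) by auto
  then show ?thesis
    using crossing_has_braid[of x "r @ y" "[]" j i q s] p assms(3) by simp
qed

lemma not_stair_has_braid:
  assumes "p \<in> incr_prefixes n n" "p \<notin> stair_prefixes n k" "1 \<le> k" "k \<le> n"
  shows "has_braid (p @ ssup n t k)"
proof -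
  obtain x q i l where p: "p = x @ seg q i @ [l..<n]" "k \<le> i" "i \<le> q" "q < n" "Suc i < l" "l \<le> n"
    using not_stair_decomp[OF assms(3,4,1,2)] by blast
  have "p \<in> words n" using prefix_words_in_words incr_subset_prefix_words assms(1) by fastforce
  then have "x \<in> words n" using p(1) by simp
  moreover have "\<forall>a \<in> set ([l..<n] @ replicate t n). Suc i < a" "i < n - 1" using p by auto
  ultimately show ?thesis
    using crossing_has_braid[of x "[]" "[l..<n] @ replicate t n" k i q "n - 1"] p assms(3) upt_in_words[of l]
    by (simp add: ssup_def)
qed

text \<open>
  A lower end below \<open>n - 1\<close> gives a three-letter braid with the first block.  If the lower end is
  \<open>n - 1\<close>, the last letter of the prefix and the first block form \<open>s\<^sub>n\<^sub>-\<^sub>1 s\<^sub>n\<^sup>t s\<^sub>n\<^sub>-\<^sub>1\<close>, and the power of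
  \<open>s\<^sub>n\<close> that opens the second block commutes up to it.
\<close>

lemma not_incr_has_braid_two_blocks:
  assumes "p \<in> incr_prefixes n n" "p \<notin> incr_prefixes n k" "1 \<le> t" "1 \<le> t'" "Suc k < n" "1 \<le> j" "j \<le> n" "y \<in> words n"
  shows "has_braid (p @ ssup n t (Suc k) @ ssup n t' j @ y)"
proof -
  obtain x q i where p: "p = x @ seg q i" "k < i" "i \<le> q" "q < n"
    using incr_decomp[OF assms(1,2)] by blast
  have "p \<in> words n" using prefix_words_in_words incr_subset_prefix_words assms(1) by fastforce
  then have xw: "x \<in> words n" using p(1) by simp
  have yw: "ssup n t' j @ y \<in> words n" using assms n_ge2 by (simp add: ssup_in_words)
  show ?thesis
  proof (cases "i < n - 1")
    case True
    then show ?thesis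
      using crossing_has_braid[of x "ssup n t' j @ y" "replicate t n" "Suc k" i q "n - 1"] p assms xw yw
      by (auto simp: ssup_def)
  next
    case False
    then have "i = n - 1" "q = n - 1" using p by auto
    then have "seg q i = [n - 1]" by simp
    let ?a = "replicate t n" and ?b = "replicate t' n" and ?s = "seg (n - 2) (Suc k)"
      and ?y = "seg (n - 1) j @ y"
    have w: "?s \<in> words n" "?y \<in> words n" "[n - 1] \<in> words n" "[n] \<in> words n"
      using n_ge2 assms by (auto intro!: seg_in_words)
    have "p @ ssup n t (Suc k) @ ssup n t' j @ y = (x @ [n - 1] @ ?a @ [n - 1]) @ (?s @ ?b) @ ?y"
      using p(1) \<open>seg q i = [n - 1]\<close> ssup_unfold[OF assms(5), of t] by (simp add: ssup_def)
    also have "\<dots> \<sim> (x @ [n - 1] @ ?a @ [n - 1]) @ (?b @ ?s) @ ?y"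
      using w xw n_ge2 by (intro comm_context word_word_commute) auto
    also have "\<dots> = x @ ([n - 1] @ ?a @ [n - 1] @ ?b) @ (?s @ ?y)" by simp
    finally show ?thesis
      by (rule has_braidI) (use four_rev[OF assms(4,3)] xw w in auto)
  qed
qed

end

section \<open>Braid-free canonical words\<close>

text \<open>
  A three-letter braid is two equal letters with a single neighbour between them.  To exclude it in
  a whole commutation class, a word is read with counters: \<open>c a\<close> counts the neighbours of \<open>a\<close>
  since the last \<open>a\<close>, and reading \<open>a < n\<close> demands that \<open>c a\<close> be at least 2.  The letter \<open>n\<close> counts
  twice, since \<open>s\<^sub>n\<^sub>-\<^sub>1 s\<^sub>n s\<^sub>n\<^sub>-\<^sub>1\<close> is no braid; starting all counters at 2 makes first occurrences
  harmless.  The updates for two commuting letters commute.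
\<close>

definition note_letter :: "nat \<Rightarrow> nat \<Rightarrow> (nat \<Rightarrow> nat) \<Rightarrow> nat \<Rightarrow> nat" where
  "note_letter n a c x = (if x = a then 0 else if x = Suc a then Suc (c x)
     else if Suc x = a then c x + (if a = n then 2 else 1) else c x)"

fun scan :: "nat \<Rightarrow> nat list \<Rightarrow> (nat \<Rightarrow> nat) \<Rightarrow> nat \<Rightarrow> nat" where
  "scan n [] c = c"
| "scan n (a # w) c = scan n w (note_letter n a c)"

fun spaced :: "nat \<Rightarrow> nat list \<Rightarrow> (nat \<Rightarrow> nat) \<Rightarrow> bool" where
  "spaced n [] c \<longleftrightarrow> True"
| "spaced n (a # w) c \<longleftrightarrow> (a < n \<longrightarrow> 2 \<le> c a) \<and> spaced n w (note_letter n a c)"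

lemma scan_append [simp]: "scan n (u @ v) c = scan n v (scan n u c)"
  by (induction u arbitrary: c) auto

lemma spaced_append [simp]: "spaced n (u @ v) c \<longleftrightarrow> spaced n u c \<and> spaced n v (scan n u c)"
  by (induction u arbitrary: c) auto

lemma spaced_swap:
  assumes "b + 1 < a \<or> a + 1 < b"
  shows "spaced n (x @ [a, b] @ y) c \<longleftrightarrow> spaced n (x @ [b, a] @ y) c"
proof -
  have "note_letter n a (note_letter n b c) = note_letter n b (note_letter n a c)" for c
    using assms by (intro ext) (auto simp: note_letter_def)
  moreover have "note_letter n a c b = c b" "note_letter n b c a = c a" for c
    using assms by (auto simp: note_letter_def)
  ultimately show ?thesis by auto
qed

lemma not_spaced_braid3:
  "\<lbrakk>i < n; j < n; i = j + 1 \<or> j = i + 1\<rbrakk> \<Longrightarrow> \<not> spaced n (x @ [i, j, i] @ y) c"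
  by (auto simp: note_letter_def)

text \<open>
  Reading a segment downwards, each letter supplies one of the two neighbours that the next one
  needs; so one earlier neighbour suffices for all letters but the first.
\<close>

lemma spaced_seg:
  assumes "1 \<le> j" "j \<le> Suc m" "m < n" "j \<le> m \<longrightarrow> 2 \<le> c m" "\<forall>x. j \<le> x \<and> x < m \<longrightarrow> 1 \<le> c x"
  shows "spaced n (seg m j) c \<and>
    (\<forall>x. (if x = j \<and> j \<le> m then 0 else if j < x \<and> x \<le> m then 1
          else if x = Suc m \<and> j \<le> m then Suc (c x) else c x) \<le> scan n (seg m j) c x)"
  using assms
proof (induction m arbitrary: c)
  case 0
  then have "seg 0 j = []" by simp
  then show ?case using 0 by simp
next
  case (Suc m)
  show ?case
  proof (cases "j \<le> Suc m")
    case True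
    define c' where "c' = note_letter n (Suc m) c"
    have c': "c' (Suc m) = 0" "c' m = Suc (c m)" "c' (Suc (Suc m)) = Suc (c (Suc (Suc m)))"
      "\<And>x. x \<noteq> Suc m \<Longrightarrow> c x \<le> c' x"
      using Suc.prems(3) by (auto simp: c'_def note_letter_def)
    have "j \<le> m \<longrightarrow> 2 \<le> c' m" using Suc.prems(5) c'(2) by auto
    moreover have "1 \<le> c' x" if "j \<le> x" "x < m" for x
      using Suc.prems(5) c'(4)[of x] that by fastforce
    ultimately have IH: "spaced n (seg m j) c'"
      "\<And>x. (if x = j \<and> j \<le> m then 0 else if j < x \<and> x \<le> m then 1
          else if x = Suc m \<and> j \<le> m then Suc (c' x) else c' x) \<le> scan n (seg m j) c' x"
      using Suc.IH[of c'] Suc.prems True by auto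
    have "(if x = j \<and> j \<le> Suc m then 0 else if j < x \<and> x \<le> Suc m then 1
          else if x = Suc (Suc m) \<and> j \<le> Suc m then Suc (c x) else c x) \<le> scan n (seg m j) c' x" for x
    proof (cases "x = Suc m")
      case True
      then show ?thesis using IH(2)[of x] c'(1) \<open>j \<le> Suc m\<close> by (auto split: if_splits)
    next
      case False
      then have "c x \<le> c' x" by (rule c'(4))
      then show ?thesis using IH(2)[of x] c'(3) False by (auto split: if_splits)
    qed
    then show ?thesis
      using IH(1) True Suc.prems by (simp add: seg_Suc c'_def)
  next
    case False
    then show ?thesis using Suc.prems by simp
  qed
qed

text \<open>
  The bounds are what \<open>spaced_seg\<close> needs for a further segment with lower end above \<open>k\<close>: the counters
  from \<open>m\<close> on serve its first letter, those above \<open>k\<close> the others.  When a block follows, the power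
  of \<open>s\<^sub>n\<close> serves its first letter \<open>n - 1\<close>.
\<close>

lemma spaced_incr:
  assumes "p \<in> incr_prefixes m k" "m \<le> n"
  shows "spaced n p (\<lambda>_. 2) \<and> (\<forall>x \<ge> m. 2 \<le> scan n p (\<lambda>_. 2) x) \<and> (\<forall>x > k. 1 \<le> scan n p (\<lambda>_. 2) x)"
  using assms
proof (induction m arbitrary: p k)
  case (Suc m)
  show ?case
  proof (cases "p \<in> incr_prefixes m k")
    case True
    then show ?thesis using Suc.IH[OF True] Suc.prems by auto
  next
    case False
    then obtain q i where q: "p = q @ seg m i" "q \<in> incr_prefixes m (i - 1)" "1 \<le> i" "i \<le> m" "i \<le> k"
      using Suc.prems(1) by auto
    let ?c = "scan n q (\<lambda>_. 2)"
    have IH: "spaced n q (\<lambda>_. 2)" "\<And>x. m \<le> x \<Longrightarrow> 2 \<le> ?c x" "\<And>x. i \<le> x \<Longrightarrow> 1 \<le> ?c x"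
      using Suc.IH[OF q(2)] Suc.prems(2) q(3) by auto
    then have "spaced n (seg m i) ?c \<and>
      (\<forall>x. (if x = i \<and> i \<le> m then 0 else if i < x \<and> x \<le> m then 1
          else if x = Suc m \<and> i \<le> m then Suc (?c x) else ?c x) \<le> scan n (seg m i) ?c x)"
      using q Suc.prems(2) by (intro spaced_seg) auto
    then have seg: "spaced n (seg m i) ?c"
      "\<And>x. (if x = i \<and> i \<le> m then 0 else if i < x \<and> x \<le> m then 1
          else if x = Suc m \<and> i \<le> m then Suc (?c x) else ?c x) \<le> scan n (seg m i) ?c x" by auto
    have "2 \<le> scan n (seg m i) ?c x" if "Suc m \<le> x" for x
      using seg(2)[of x] IH(2)[of x] that q by (auto split: if_splits)
    moreover have "1 \<le> scan n (seg m i) ?c x" if "k < x" for x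
      using seg(2)[of x] IH(3)[of x] that q by (auto split: if_splits)
    ultimately show ?thesis using IH(1) seg(1) q(1) by simp
  qed
qed simp

lemma scan_last_power:
  "spaced n (replicate t n) c \<and>
   scan n (replicate t n) c x = (if t = 0 then c x else if x = n then 0 else if x = Suc n then c x + t
     else if Suc x = n then c x + 2 * t else c x)"
  by (induction t arbitrary: c) (auto simp: note_letter_def)

lemma spaced_ssup:
  assumes "1 \<le> t" "1 \<le> j" "j \<le> n" "\<forall>x. j \<le> x \<and> Suc x < n \<longrightarrow> 1 \<le> c x"
  shows "spaced n (ssup n t j) c \<and> (\<forall>x. j < x \<and> x < n \<longrightarrow> 1 \<le> scan n (ssup n t j) c x)"
proof -
  let ?c = "scan n (replicate t n) c"
  have c: "j \<le> n - 1 \<longrightarrow> 2 \<le> ?c (n - 1)" "\<forall>x. j \<le> x \<and> x < n - 1 \<longrightarrow> 1 \<le> ?c x"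
    using assms scan_last_power[of n t c] by auto
  have "spaced n (seg (n - 1) j) ?c \<and>
    (\<forall>x. (if x = j \<and> j \<le> n - 1 then 0 else if j < x \<and> x \<le> n - 1 then 1
          else if x = Suc (n - 1) \<and> j \<le> n - 1 then Suc (?c x) else ?c x) \<le> scan n (seg (n - 1) j) ?c x)"
    using assms(2,3) c by (intro spaced_seg) auto
  then have seg: "spaced n (seg (n - 1) j) ?c"
    "\<And>x. (if x = j \<and> j \<le> n - 1 then 0 else if j < x \<and> x \<le> n - 1 then 1
          else if x = Suc (n - 1) \<and> j \<le> n - 1 then Suc (?c x) else ?c x) \<le> scan n (seg (n - 1) j) ?c x"
    by auto
  have "1 \<le> scan n (seg (n - 1) j) ?c x" if "j < x" "x < n" for x
    using seg(2)[of x] that by (auto split: if_splits)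
  then show ?thesis using seg(1) scan_last_power[of n t c] by (simp add: ssup_def)
qed

lemma spaced_suffix:
  assumes "ps \<in> suffix_data d n" "\<forall>x. k < x \<and> x < n \<longrightarrow> 1 \<le> c x" "\<forall>j \<in> snd ` set ps. k < j"
  shows "spaced n (suffix_word n ps) c"
  using assms
proof (induction ps arbitrary: k c)
  case (Cons tj ps)
  obtain t j where tj: "tj = (t, j)" by fastforce
  have "spaced n (ssup n t j) c \<and> (\<forall>x. j < x \<and> x < n \<longrightarrow> 1 \<le> scan n (ssup n t j) c x)"
    using Cons.prems tj by (intro spaced_ssup) auto
  moreover have "spaced n (suffix_word n ps) (scan n (ssup n t j) c)"
    using Cons.prems tj calculation by (intro Cons.IH[of j]) auto
  ultimately show ?case using tj by simp
qed simp

lemma spaced_run: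
  assumes "l \<le> m" "m \<le> n" "\<forall>x \<ge> l. 2 \<le> c x" "\<forall>x \<ge> k. 1 \<le> c x"
  shows "spaced n [l..<m] c \<and> (\<forall>x \<ge> m. 2 \<le> scan n [l..<m] c x)
    \<and> (\<forall>x. k \<le> x \<and> Suc x < m \<longrightarrow> 1 \<le> scan n [l..<m] c x)"
  using assms
proof (induction m rule: dec_induct)
  case (step m)
  let ?c = "scan n [l..<m] c"
  have IH: "spaced n [l..<m] c" "\<And>x. m \<le> x \<Longrightarrow> 2 \<le> ?c x" "\<And>x. k \<le> x \<Longrightarrow> Suc x < m \<Longrightarrow> 1 \<le> ?c x"
    using step by auto
  have "2 \<le> note_letter n m ?c x" if "Suc m \<le> x" for x using IH(2)[of x] that by (auto simp: note_letter_def)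
  moreover have "1 \<le> note_letter n m ?c x" if "k \<le> x" "Suc x < Suc m" for x
    using IH(3)[of x] that by (auto simp: note_letter_def)
  ultimately show ?case using IH step.hyps by simp
qed simp

lemma spaced_stair:
  assumes "p \<in> stair_prefixes n k" "1 \<le> k" "k \<le> n" "1 \<le> t"
  shows "spaced n (p @ ssup n t k) (\<lambda>_. 2)"
proof -
  obtain x l where p: "p = x @ [l..<n]" "x \<in> incr_prefixes l (k - 1)" "k \<le> l" "l \<le> n"
    using assms(1) by (auto simp: stair_prefixes_def)
  let ?c = "scan n x (\<lambda>_. 2)"
  have x: "spaced n x (\<lambda>_. 2)" "\<forall>y \<ge> l. 2 \<le> ?c y" "\<forall>y \<ge> k. 1 \<le> ?c y"
    using spaced_incr[OF p(2,4)] assms(2) by auto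
  have run: "spaced n [l..<n] ?c \<and> (\<forall>y \<ge> n. 2 \<le> scan n [l..<n] ?c y)
    \<and> (\<forall>y. k \<le> y \<and> Suc y < n \<longrightarrow> 1 \<le> scan n [l..<n] ?c y)"
    using spaced_run[OF p(4) order_refl x(2,3)] .
  then have "spaced n (ssup n t k) (scan n [l..<n] ?c)"
    using spaced_ssup[OF assms(4,2,3)] by blast
  then show ?thesis using run x(1) p(1) by simp
qed

text \<open>
  A word whose letters \<open>n\<close> form a single run contains no \<open>n m n\<close>, whereas each side of a braid
  that involves \<open>n\<close> contains \<open>n (n - 1) n\<close>.
\<close>

lemma no_isolated_letter:
  assumes "n \<notin> set A" "n \<notin> set B" "m \<noteq> n"
  shows "A @ replicate t n @ B \<noteq> X @ [n, m, n] @ Y"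
  using assms(1)
proof (induction A arbitrary: X)
  case Nil
  show ?case
  proof (induction t arbitrary: X)
    case 0
    then show ?case using assms(2) by auto
  next
    case (Suc t)
    show ?case
    proof (cases X)
      case Nil
      have "replicate t n @ B \<noteq> m # n # Y" using assms(2,3) by (cases t) auto
      then show ?thesis using Nil by simp
    next
      case (Cons x X')
      then show ?thesis using Suc.IH[of X'] by auto
    qed
  qed
next
  case (Cons a A)
  then show ?case by (cases X) auto
qed

context cyclotomic
begin

lemma comm_spaced:
  assumes "u \<sim> v"
  shows "spaced n u c \<longleftrightarrow> spaced n v c"
  using assms unfolding comm_equiv_def
proof (induction rule: rtrancl_induct)
  case (step v w)
  then obtain x y a b where "v = x @ [a, b] @ y" "w = x @ [b, a] @ y" "b + 1 < a \<or> a + 1 < b"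
    unfolding comm_step_def by blast
  then show ?case using step.IH spaced_swap[of b a n x y c] by simp
qed simp

lemma braid_shape:
  assumes "braid l r"
  obtains (three) i j where "l = [i, j, i]" "i < n" "j < n" "i = j + 1 \<or> j = i + 1"
  | (four) u v b x y where "l = u @ [n, n - 1, n] @ v" "l = x @ [n - 1] @ replicate b n @ [n - 1] @ y"
      "n \<ge> 2"
  using assms
proof cases
  case (three i j)
  then show ?thesis using that(1) by blast
next
  case (four a b)
  obtain a' b' where ab: "a = Suc a'" "b = Suc b'" using four by (cases a; cases b) auto
  have "l = replicate a' n @ [n, n - 1, n] @ (replicate b' n @ [n - 1])"
    using four ab by (simp add: replicate_app_Cons_same)
  moreover have "l = replicate a n @ [n - 1] @ replicate b n @ [n - 1] @ []" using four by simp
  ultimately show ?thesis using that(2) n_ge2 by blast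
next
  case (four_rev a b)
  obtain a' b' where ab: "a = Suc a'" "b = Suc b'" using four_rev by (cases a; cases b) auto
  have "l = ([n - 1] @ replicate b' n) @ [n, n - 1, n] @ replicate a' n"
    using four_rev ab by (simp add: replicate_app_Cons_same)
  moreover have "l = [] @ [n - 1] @ replicate b n @ [n - 1] @ replicate a n" using four_rev by simp
  ultimately show ?thesis using that(2) n_ge2 by blast
qed

lemma no_braid_one_block:
  assumes "spaced n (p @ replicate t n @ s) c" "n \<notin> set p" "n \<notin> set s"
  shows "\<not> has_braid (p @ replicate t n @ s)"
proof
  assume "has_braid (p @ replicate t n @ s)"
  then obtain x y l r where b: "p @ replicate t n @ s \<sim> x @ l @ y" "braid l r"
    unfolding has_braid_def by blast
  from b(2) show False
  proof (cases rule: braid_shape)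
    case (three i j)
    then show ?thesis using comm_spaced[OF b(1)] assms(1) not_spaced_braid3[of i n j x y c] by blast
  next
    case (four u v b' x' y')
    let ?f = "filter (\<lambda>a. a = n - 1 \<or> a = Suc (n - 1))"
    have "?f (p @ replicate t n @ s) = ?f (x @ l @ y)" using comm_filter[OF b(1)] .
    then have eq: "?f p @ replicate t n @ ?f s = (?f x @ ?f u) @ [n, n - 1, n] @ (?f v @ ?f y)"
      using four(3) by (simp add: four(1) filter_const)
    have "n \<notin> set (?f p)" "n \<notin> set (?f s)" "n - 1 \<noteq> n" using assms(2,3) four(3) by auto
    from no_isolated_letter[OF this] eq show False by (rule notE)
  qed
qed

text \<open>
  With two or more blocks the letters \<open>n\<close> no longer form one run.  Here the braids
  that involve \<open>n\<close> are excluded because their two letters \<open>n - 1\<close> have no \<open>n - 2\<close> between them, whereas in the words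
  considered every \<open>n - 1\<close> but the last one is followed by an \<open>n - 2\<close> before the next \<open>n - 1\<close>.
\<close>

definition separated :: "nat list \<Rightarrow> bool" where
  "separated w \<longleftrightarrow> successively (\<lambda>a b. a = n - 1 \<longrightarrow> b \<noteq> n - 1) (filter (\<lambda>a. a = n - 2 \<or> a = n - 1) w)"

lemma separated_append:
  assumes "separated u" "separated v"
    and "filter (\<lambda>a. a = n - 2 \<or> a = n - 1) u = [] \<or> last (filter (\<lambda>a. a = n - 2 \<or> a = n - 1) u) \<noteq> n - 1"
  shows "separated (u @ v)"
  using assms by (auto simp: separated_def successively_append_iff)

lemma filter_no_pred:
  assumes "n - 1 \<notin> set w"
  shows "separated w" and "filter (\<lambda>a. a = n - 2 \<or> a = n - 1) w = [] \<or> last (filter (\<lambda>a. a = n - 2 \<or> a = n - 1) w) \<noteq> n - 1"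
proof -
  let ?f = "filter (\<lambda>a. a = n - 2 \<or> a = n - 1)"
  have *: "n - 1 \<notin> set (?f w)" using assms by simp
  then show "?f w = [] \<or> last (?f w) \<noteq> n - 1" by (metis last_in_set)
  have "successively (\<lambda>a b. a = n - 1 \<longrightarrow> b \<noteq> n - 1) xs" if "n - 1 \<notin> set xs" for xs
    using that by (induction xs rule: induct_list012) auto
  then show "separated w" using * by (simp add: separated_def)
qed

lemma filter_seg:
  assumes "1 \<le> j" "j \<le> n - 2"
  shows "filter (\<lambda>a. a = n - 2 \<or> a = n - 1) (seg (n - 1) j) = [n - 1, n - 2]"
proof -
  have "seg (n - 1) j = (n - 1) # (n - 2) # seg (n - 3) j"
    using assms seg_Suc[of j "n - 2"] seg_Suc[of j "n - 3"] by (simp add: numeral_eq_Suc Suc_diff_Suc)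
  moreover have "filter (\<lambda>a. a = n - 2 \<or> a = n - 1) (seg (n - 3) j) = []"
    using assms by (auto simp: filter_empty_conv)
  ultimately show ?thesis by simp
qed

lemma separated_suffix:
  assumes "ps \<in> suffix_data d n"
  shows "separated (suffix_word n ps)"
  using assms
proof (induction ps)
  case Nil
  then show ?case by (simp add: separated_def)
next
  case (Cons tj ps)
  let ?f = "filter (\<lambda>a. a = n - 2 \<or> a = n - 1)"
  obtain t j where tj: "tj = (t, j)" by fastforce
  with Cons.prems have data: "1 \<le> j" "j \<le> n" "ps \<in> suffix_data d n" "\<forall>j' \<in> snd ` set ps. j < j'" by auto
  have f: "?f (ssup n t j) = ?f (seg (n - 1) j)" using n_ge2 by (auto simp: ssup_def filter_const)
  consider "j \<le> n - 2" | "j = n - 1" | "j = n" using data by linarith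
  then show ?case
  proof cases
    case 1
    then have "?f (ssup n t j) = [n - 1, n - 2]" using f filter_seg data by simp
    then show ?thesis
      using separated_append[of "ssup n t j" "suffix_word n ps"] Cons.IH data tj n_ge2
      by (simp add: separated_def)
  next
    case 2
    have "?f (suffix_word n qs) = []" if "qs \<in> suffix_data d n" "\<forall>j' \<in> snd ` set qs. n - 1 < j'" for qs
      using that
    proof (induction qs)
      case (Cons q qs)
      then show ?case using n_ge2 by (cases q) (auto simp: ssup_def filter_const)
    qed simp
    then have "?f (suffix_word n (tj # ps)) = [n - 1]" using 2 data f tj by simp
    then show ?thesis by (simp add: separated_def)
  next
    case 3
    then have "?f (ssup n t j) = []" using f n_ge2 by simp
    then show ?thesis using Cons.IH data tj by (simp add: separated_def)
  qed
qed

lemma separated_canonical: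
  assumes "p \<in> incr_prefixes n k" "k \<le> n - 2" "ps \<in> suffix_data d n"
  shows "separated (p @ suffix_word n ps)"
proof -
  let ?f = "filter (\<lambda>a. a = n - 2 \<or> a = n - 1)"
  obtain m where m: "n = Suc m" using n_ge2 by (cases n) auto
  have "separated p \<and> (?f p = [] \<or> last (?f p) \<noteq> n - 1)"
  proof (cases "p \<in> incr_prefixes m k")
    case True
    then have "n - 1 \<notin> set p" using incr_set[OF True] m by auto
    then show ?thesis using filter_no_pred by blast
  next
    case False
    then obtain q i where q: "p = q @ seg m i" "q \<in> incr_prefixes m (i - 1)" "1 \<le> i" "i \<le> k"
      using assms(1) m by auto
    have "n - 1 \<notin> set q" using incr_set[OF q(2)] m by auto
    then have sq: "separated q" "?f q = [] \<or> last (?f q) \<noteq> n - 1" using filter_no_pred by blast+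
    have f: "?f (seg m i) = [n - 1, n - 2]" using filter_seg[of i] q assms(2) m by simp
    moreover have "n - 1 \<noteq> n - 2" using n_ge2 by simp
    ultimately have "separated (seg m i)" by (simp add: separated_def)
    with sq have "separated p" using separated_append[of q "seg m i"] q(1) by blast
    moreover have "last (?f p) \<noteq> n - 1" using f q(1) n_ge2 by simp
    ultimately show ?thesis by blast
  qed
  then show ?thesis using separated_append separated_suffix[OF assms(3)] by blast
qed

lemma no_braid_separated:
  assumes "spaced n w c" "separated w"
  shows "\<not> has_braid w"
proof
  assume "has_braid w"
  then obtain x y l r where b: "w \<sim> x @ l @ y" "braid l r"
    unfolding has_braid_def by blast
  from b(2) show False
  proof (cases rule: braid_shape)
    case (three i j)
    then show ?thesis using comm_spaced[OF b(1)] assms(1) not_spaced_braid3[of i n j x y c] by blast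
  next
    case (four u v b' x' y')
    let ?f = "filter (\<lambda>a. a = n - 2 \<or> a = n - 1)"
    have "?f w = ?f (x @ l @ y)" using comm_filter[OF b(1), of "n - 2"] four(3)
      by (simp add: numeral_2_eq_2 Suc_diff_Suc)
    also have "\<dots> = (?f x @ ?f x') @ [n - 1, n - 1] @ (?f y' @ ?f y)"
    proof -
      have "n \<noteq> n - 1" "n \<noteq> n - 2" using four(3) by arith+
      then show ?thesis by (simp add: four(2) filter_const)
    qed
    finally show False using assms(2) by (simp add: separated_def successively_append_iff)
  qed
qed

section \<open>The sizes of the collections\<close>

lemma collection_eq:
  assumes "ps \<in> suffix_data d n"
  shows "collection d n (suffix_word n ps) =
    (\<lambda>p. p @ suffix_word n ps) ` {p \<in> prefix_words n. \<not> has_braid (p @ suffix_word n ps)}"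
  unfolding collection_def prefixes_eq using fully_commutative_iff canonicalI[OF _ assms] by blast

lemma collection_card:
  assumes "ps \<in> suffix_data d n" "{p \<in> prefix_words n. \<not> has_braid (p @ suffix_word n ps)} = A" "finite A"
  shows "finite (collection d n (suffix_word n ps)) \<and> card (collection d n (suffix_word n ps)) = card A"
  unfolding collection_eq[OF assms(1)] assms(2) using assms(3) by (simp add: card_image inj_on_def)

lemma collection_no_block:
  "finite (collection d n (suffix_word n [])) \<and>
   real (card (collection d n (suffix_word n []))) = catalan_triangle n n"
proof -
  have "\<not> has_braid p" if "p \<in> incr_prefixes n n" for p
  proof -
    have "n \<notin> set p" using incr_set[OF that] by auto
    then show ?thesis
      using no_braid_one_block[of p 0 "[]" "\<lambda>_. 2"] spaced_incr[OF that order_refl] by simp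
  qed
  then have "{p \<in> prefix_words n. \<not> has_braid (p @ suffix_word n [])} = incr_prefixes n n"
    using not_incr_has_braid[of _ "[]"] incr_subset_prefix_words[of n n] by auto
  then show ?thesis using collection_card[of "[]"] card_incr[of n n] finite_incr by simp
qed

lemma collection_one_block:
  assumes "1 \<le> t" "t \<le> d - 1" "1 \<le> k" "k \<le> n"
  shows "finite (collection d n (suffix_word n [(t, k)])) \<and>
    real (card (collection d n (suffix_word n [(t, k)]))) = catalan_triangle n k"
proof -
  have data: "[(t, k)] \<in> suffix_data d n" using assms by simp
  have sub: "stair_prefixes n k \<subseteq> prefix_words n"
  proof -
    have "p @ [l..<l + i] \<in> prefix_words (l + i)" if "p \<in> incr_prefixes l j" "1 \<le> l" for p l j i
    proof (induction i)
      case 0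
      then show ?case using that incr_subset_prefix_words by auto
    next
      case (Suc i)
      then show ?case using prefix_words_SucI[of "p @ [l..<l + i]" "l + i" "l + i"] that by simp
    qed
    then have "p @ [l..<n] \<in> prefix_words n" if "p \<in> incr_prefixes l j" "1 \<le> l" "l \<le> n" for p l j
      using that by (metis le_add_diff_inverse)
    then show ?thesis using assms(3) by (auto simp: stair_prefixes_def)
  qed
  have "\<not> has_braid (p @ ssup n t k)" if "p \<in> stair_prefixes n k" for p
  proof -
    have "n \<notin> set p" "n \<notin> set (seg (n - 1) k)"
      using set_prefix_words[OF subsetD[OF sub that]] n_ge2 by auto
    then show ?thesis
      using no_braid_one_block[of p t "seg (n - 1) k" "\<lambda>_. 2"] spaced_stair[OF that assms(3,4,1)]
      by (simp add: ssup_def)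
  qed
  moreover have "has_braid (p @ ssup n t k)" if "p \<in> prefix_words n" "p \<notin> stair_prefixes n k" for p
    using not_incr_has_braid[OF that(1)] not_stair_has_braid[OF _ that(2)] assms n_ge2
    by (cases "p \<in> incr_prefixes n n") (auto simp: ssup_in_words)
  ultimately have "{p \<in> prefix_words n. \<not> has_braid (p @ suffix_word n [(t, k)])} = stair_prefixes n k"
    using sub by auto
  then show ?thesis
    using collection_card[OF data] card_stair[OF assms(3,4)] card_incr[OF assms(4)] finite_stair by simp
qed

lemma collection_more_blocks:
  assumes "(t, Suc k) # ps \<in> suffix_data d n" "ps \<noteq> []"
  shows "finite (collection d n (suffix_word n ((t, Suc k) # ps))) \<and>
    real (card (collection d n (suffix_word n ((t, Suc k) # ps)))) = catalan_triangle n k"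
proof -
  obtain t' j qs where ps: "ps = (t', j) # qs" using assms(2) by (cases ps) auto
  have data: "1 \<le> t" "1 \<le> t'" "Suc k < j" "j \<le> n" "qs \<in> suffix_data d n"
    using assms(1) ps by auto
  let ?w = "suffix_word n ((t, Suc k) # ps)"
  have ww: "?w \<in> words n" using suffix_in_words[OF _ assms(1)] n_ge2 by simp
  have "\<not> has_braid (p @ ?w)" if "p \<in> incr_prefixes n k" for p
  proof (rule no_braid_separated)
    show "separated (p @ ?w)" using separated_canonical[OF that _ assms(1)] data by simp
    have "spaced n ?w (scan n p (\<lambda>_. 2))"
      using spaced_incr[OF that order_refl] assms(1) by (intro spaced_suffix[OF assms(1), of k]) auto
    then show "spaced n (p @ ?w) (\<lambda>_. 2)" using spaced_incr[OF that order_refl] by simp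
  qed
  moreover have "has_braid (p @ ?w)" if "p \<in> prefix_words n" "p \<notin> incr_prefixes n k" for p
  proof (cases "p \<in> incr_prefixes n n")
    case True
    then show ?thesis
      using not_incr_has_braid_two_blocks[OF True that(2), of t t' j "suffix_word n qs"] data ps n_ge2
        suffix_in_words[OF _ data(5)] by simp
  next
    case False
    then show ?thesis using not_incr_has_braid[OF that(1) _ ww] by blast
  qed
  ultimately have "{p \<in> prefix_words n. \<not> has_braid (p @ ?w)} = incr_prefixes n k"
    using incr_subset_prefix_words[of n k] by auto
  then show ?thesis
    using collection_card[OF assms(1)] card_incr[of k n] data finite_incr by simp
qed

end

theorem theorem4p9:
  fixes d n k :: nat and c :: "nat list set"
  assumes "d \<ge> 1" and "n \<ge> 3" and "k \<le> n" and "c \<in> packet d n k"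
  shows "finite c \<and> real (card c) = catalan_triangle n k"
proof -
  interpret cyclotomic d n using assms by unfold_locales auto
  obtain w where c: "c = collection d n w" and w: "w \<in> packet_labels d n k"
    using assms(4) by (auto simp: packet_def)
  consider "k = n" | "k = n - 1" "k \<noteq> n" | "k = 0" "k \<noteq> n - 1" "k \<noteq> n" | "k \<noteq> 0" "k \<noteq> n - 1" "k \<noteq> n" by blast
  then show ?thesis
  proof cases
    case 1
    then show ?thesis using w c collection_no_block by (simp add: packet_labels_def)
  next
    case 2
    then obtain t j where tj: "w = suffix_word n [(t, j)]" "1 \<le> t" "t \<le> d - 1" "j = n \<or> j = n - 1"
      using w by (auto simp: packet_labels_def)
    have "catalan_triangle n n = catalan_triangle n (n - 1)"
      using catalan_triangle_top[of "n - 1"] assms(2) by simp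
    then show ?thesis using collection_one_block[OF tj(2,3), of j] tj(1,4) c 2 assms(2) by auto
  next
    case 3
    then obtain t ps where "w = suffix_word n ((t, Suc 0) # ps)" "(t, Suc 0) # ps \<in> suffix_data d n" "ps \<noteq> []"
      using w by (auto simp: packet_labels_def)
    then show ?thesis using collection_more_blocks c 3 by blast
  next
    case 4
    then consider t where "w = suffix_word n [(t, k)]" "1 \<le> t" "t \<le> d - 1"
      | t ps where "w = suffix_word n ((t, Suc k) # ps)" "(t, Suc k) # ps \<in> suffix_data d n" "ps \<noteq> []"
      using w by (auto simp: packet_labels_def)
    then show ?thesis
    proof cases
      case 1
      then show ?thesis using collection_one_block[OF 1(2,3), of k] c 4 assms(3) by simp
    next
      case 2
      then show ?thesis using collection_more_blocks c by blast
    qed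
  qed
qed

end
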